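(* Consider the FSIPL algorithm described in the context, and assume that its parameter $\alpha$ satisfies $$\alpha>\max\Big\{\frac{M_1}{C_1},\ M_2+\frac{\sigma\hat\tau^2}{2}\Big\},\qquad M_1:=\sqrt{C_2}(\ell_f+\ell_g\ell_{\mathcal A}),\quad M_2:=\kappa(\ell_f+\ell_g\ell_{\mathcal A}),\quad \hat\tau:=\min\Big\{\frac{2\kappa C_1}{\theta L_hC_2},\frac1{C_2}\Big\},$$ and that $\{\Delta_k\}_{k\in\mathbb N}$ is summable. Let $\{x^k\}_{k\in\mathbb N}$ be the sequence generated by the algorithm. Then any cluster point of $\{x^k\}_{k\in\mathbb N}$ is a stationary point of the problem $\min_{x\in\mathcal M}F(x)$.
   Context: Notation. $\|\cdot\|$ is the Euclidean norm (spectral norm for matrices). For a smooth map $\psi:\mathbb R^n\to\mathbb R^m$ with $m$ components, $\nabla\psi(x)\in\mathbb R^{m\times n}$ is its Jacobian; for real-valued $f$, $\nabla f(x)\in\mathbb R^n$ is the gradient. For closed convex $g$ and $t>0$: $M_g^t(x):=\min_y\{g(y)+\frac1{2t}\|y-x\|^2\}$ and $\mathrm{prox}_{tg}(x)$ is the unique minimizer. $\partial g$ is the convex subdifferential. $\mathcal S$ is the set of nonnegative summable real sequences. Problem. $\mathcal M\subseteq\mathbb R^n$ is a compact embedded submanifold, $\mathcal M_a:=\{x:\mathrm{dist}(x,\mathcal M)\le a\}$, and the problem is $\min_{x\in\mathcal M}F(x):=f(x)+g(\mathcal A(x))$, where $f:\mathbb R^n\to\mathbb R$ and $\mathcal A:\mathbb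 R^n\to\mathbb R^p$ are continuously differentiable and $g:\mathbb R^p\to\mathbb R$ is closed and convex. Standing assumptions: (i) $\mathcal M=\{x:h(x)=0\}$ for some $h:\mathbb R^n\to\mathbb R^m$, and there is $\kappa>0$ with $\mathrm{dist}(x,\mathcal M)\le\kappa\|h(x)\|$ for all $x\in\mathbb R^n$; (ii) $\nabla h$ is $L_h$-Lipschitz on $\mathbb R^n$, and there are $\theta>0$, $0<C_1\le C_2$ such that for all $x\in\mathcal M_{2\theta}$ the eigenvalues of $\nabla h(x)\nabla h(x)^\top$ lie in $[C_1,C_2]$; (iii) $\nabla f$ is $L_f$-Lipschitz on $\mathbb R^n$; (iv) $g$ is $\ell_g$-Lipschitz on $\mathbb R^p$; (v) $\nabla\mathcal A$ is $L_{\mathcal A}$-Lipschitz on $\mathbb R^n$. Constants $\ell_f,\ell_{\mathcal A}>0$ are fixed with $\|\nabla f(x)\|\le\ell_f$ and $\|\nabla\mathcal A(x)\|\le\ell_{\mathcal A}$ for all $x\in\mathcal M_{2\theta}$. $L_h>0$. Stationarity. $x^*$ is a stationary point of the problem if $h(x^* )=0$ and there exists $\lambda^*\in\mathbb R^m$ with $0\in\nabla f(x^* )+\nabla\mathcal A(x^* )^\top\partial g(\mathcal A(x^* ))+\nabla h(x^* )^\top\lambda^*$. FSIPL algorithm. Inputs: $x^0\in\mathcal M$, $\gamma\in(0,1)$, $\alpha>0$, positive numbers $\underline t\le\overline t$, $\overline\Delta,\overline\eta,\overline\tau,\sigma$, the constants $\theta,\kappa$ above, and $\{\rho_k\}\in\mathcal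 S$. Put $N(x):=\frac12\|h(x)\|^2$ (so $\nabla N(x)=\nabla h(x)^\top h(x)$) and $\Phi_\alpha(x):=F(x)+\alpha\|h(x)\|$. For $k=0,1,2,\dots$: 1. Choose $t_k\in[\underline t,\overline t]$, $\Delta_k\in[0,\overline\Delta]$. 2. Find $(\lambda^k,\mu^k)\in\mathbb R^m\times\mathbb R^p$ with $\|\nabla G_k(\lambda^k,\mu^k)\|\le\Delta_k$, where $G_k(\lambda,\mu):=\frac{t_k}2\|\nabla f(x^k)+\nabla h(x^k)^\top\lambda+\nabla\mathcal A(x^k)^\top\mu\|^2+\frac{t_k}2\|\mu\|^2-M_g^{t_k}(\mathcal A(x^k)+t_k\mu)$ (a convex $C^1$ function). 3. Set $d^k:=-t_k(\nabla f(x^k)+\nabla h(x^k)^\top\lambda^k+\nabla\mathcal A(x^k)^\top\mu^k)$ and $v^k:=\mathrm{prox}_{t_kg}(\mathcal A(x^k)+t_k\mu^k)-\mathcal A(x^k)$. 4. Set $\eta_k\leftarrow\overline\eta$, $\tau_k\leftarrow\overline\tau$. 5. (Inner loop) Set $y^k:=x^k+\eta_kd^k$, and $\hat x^{k+1}:=y^k-\tau_k\nabla N(y^k)$ if $\|h(y^k)\|\le\theta/\kappa$, otherwise $\hat x^{k+1}:=$ a nearest point of $\mathcal M$ to $y^k$. If $\|h(\hat x^{k+1})\|\le\theta/\kappa$ and $\Phi_\alpha(\hat x^{k+1})\le\Phi_\alpha(x^k)-\frac\sigma2(\eta_k^2\|d^k\|^2+\tau_k^2\|h(y^k)\|)-\frac{\eta_k}{2t_k}\|v^k\|^2+\eta_k(\alpha+\ell_g+\|\lambda^k\|+\|\mu^k\|)\Delta_k+\rho_k$,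 accept: $x^{k+1}\leftarrow\hat x^{k+1}$ and go to the next $k$. Otherwise reject: $\eta_k\leftarrow\gamma\eta_k$, $\tau_k\leftarrow\frac\gamma2\tau_k$, and repeat step 5. *)

theory Defs
  imports "HOL-Analysis.Analysis"
begin

(* The Euclidean gradient of a real-valued function; meaningful where f is differentiable. *)
definition gradient :: "('a::real_inner \<Rightarrow> real) \<Rightarrow> 'a \<Rightarrow> 'a" where
  "gradient f x = (THE D. GDERIV f x :> D)"

abbreviation jac :: "(real^'n \<Rightarrow> real^'m) \<Rightarrow> real^'n \<Rightarrow> real^'n^'m" where
  "jac \<psi> x \<equiv> jacobian \<psi> (at x)"

(* The norm that the library puts on the type real^'n^'m is the Frobenius norm. *)
definition spectral_norm :: "real^'n^'m \<Rightarrow> real" where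
  "spectral_norm B = onorm ((*v) B)"

definition is_eigenvalue :: "real^'m^'m \<Rightarrow> real \<Rightarrow> bool" where
  "is_eigenvalue B e \<longleftrightarrow> (\<exists>v. v \<noteq> 0 \<and> B *v v = e *\<^sub>R v)"

definition C1_map_on :: "(real^'n) set \<Rightarrow> (real^'n \<Rightarrow> real^'m) \<Rightarrow> bool" where
  "C1_map_on U \<psi> \<longleftrightarrow> (\<forall>x\<in>U. \<psi> differentiable (at x)) \<and> continuous_on U (jac \<psi>)"

(* Local straightening charts of one common dimension. The regularity is only C^1: this is the
   weakest reading, hence the most general one as a hypothesis. *)
definition embedded_submanifold :: "(real^'n) set \<Rightarrow> bool" where
  "embedded_submanifold M \<longleftrightarrow>
    (\<exists>S::(real^'n) set. subspace S \<and>
      (\<forall>x\<in>M. \<exists>U V \<phi> \<psi>. open U \<and> x \<in> U \<and> open V \<and> homeomorphism U V \<phi> \<psi> \<and>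
        C1_map_on U \<phi> \<and> C1_map_on V \<psi> \<and> \<phi> ` (M \<inter> U) = S \<inter> V))"

definition tube :: "(real^'n) set \<Rightarrow> real \<Rightarrow> (real^'n) set" where
  "tube M a = {x. infdist x M \<le> a}"

definition moreau_env :: "('a::real_inner \<Rightarrow> real) \<Rightarrow> real \<Rightarrow> 'a \<Rightarrow> real" where
  "moreau_env g t x = (INF y. g y + 1 / (2 * t) * (norm (y - x))\<^sup>2)"

(* prox t g is the proximal map of the function t g. *)
definition prox :: "real \<Rightarrow> ('a::real_inner \<Rightarrow> real) \<Rightarrow> 'a \<Rightarrow> 'a" where
  "prox t g x = (THE y. is_arg_min (\<lambda>y. g y + 1 / (2 * t) * (norm (y - x))\<^sup>2) (\<lambda>_. True) y)"

definition subdifferential :: "('a::real_inner \<Rightarrow> real) \<Rightarrow> 'a \<Rightarrow> 'a set" where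
  "subdifferential g x = {s. \<forall>y. g y \<ge> g x + s \<bullet> (y - x)}"

definition objective ::
  "(real^'n \<Rightarrow> real) \<Rightarrow> (real^'p \<Rightarrow> real) \<Rightarrow> (real^'n \<Rightarrow> real^'p) \<Rightarrow> real^'n \<Rightarrow> real" where
  "objective f g A x = f x + g (A x)"

definition stationary_point ::
  "(real^'n \<Rightarrow> real) \<Rightarrow> (real^'p \<Rightarrow> real) \<Rightarrow> (real^'n \<Rightarrow> real^'p) \<Rightarrow> (real^'n \<Rightarrow> real^'m) \<Rightarrow>
    real^'n \<Rightarrow> bool" where
  "stationary_point f g A h x \<longleftrightarrow> h x = 0 \<and>
    (\<exists>lam. 0 \<in> (\<lambda>s. gradient f x + transpose (jac A x) *v s + transpose (jac h x) *v lam)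
                  ` subdifferential g (A x))"

definition infeasibility :: "(real^'n \<Rightarrow> real^'m) \<Rightarrow> real^'n \<Rightarrow> real" where
  "infeasibility h x = 1 / 2 * (norm (h x))\<^sup>2"

definition merit ::
  "(real^'n \<Rightarrow> real) \<Rightarrow> (real^'p \<Rightarrow> real) \<Rightarrow> (real^'n \<Rightarrow> real^'p) \<Rightarrow> (real^'n \<Rightarrow> real^'m) \<Rightarrow>
    real \<Rightarrow> real^'n \<Rightarrow> real" where
  "merit f g A h \<alpha> x = objective f g A x + \<alpha> * norm (h x)"

definition dual_residual ::
  "(real^'n \<Rightarrow> real) \<Rightarrow> (real^'n \<Rightarrow> real^'p) \<Rightarrow> (real^'n \<Rightarrow> real^'m) \<Rightarrow>
    real^'n \<Rightarrow> real^'m \<Rightarrow> real^'p \<Rightarrow> real^'n" where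
  "dual_residual f A h x lam \<mu> =
    gradient f x + transpose (jac h x) *v lam + transpose (jac A x) *v \<mu>"

definition dual_objective ::
  "(real^'n \<Rightarrow> real) \<Rightarrow> (real^'p \<Rightarrow> real) \<Rightarrow> (real^'n \<Rightarrow> real^'p) \<Rightarrow> (real^'n \<Rightarrow> real^'m) \<Rightarrow>
    real \<Rightarrow> real^'n \<Rightarrow> (real^'m) \<times> (real^'p) \<Rightarrow> real" where
  "dual_objective f g A h t x = (\<lambda>(lam, \<mu>).
    t / 2 * (norm (dual_residual f A h x lam \<mu>))\<^sup>2 + t / 2 * (norm \<mu>)\<^sup>2
      - moreau_env g t (A x + t *\<^sub>R \<mu>))"

(* A relation rather than a function, since the nearest point of M need not be unique;
   r is the infeasibility threshold. *)
definition is_trial_point ::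
  "(real^'n) set \<Rightarrow> (real^'n \<Rightarrow> real^'m) \<Rightarrow> real \<Rightarrow> real \<Rightarrow> real^'n \<Rightarrow> real^'n \<Rightarrow> bool" where
  "is_trial_point M h r \<tau> y z \<longleftrightarrow>
    (if norm (h y) \<le> r then z = y - \<tau> *\<^sub>R gradient (infeasibility h) y
     else is_arg_min (dist y) (\<lambda>w. w \<in> M) z)"

end

(* At an approximate stationary point of the dual objective, J_h d and v - J_A d have norm at most
   Delta_k, and mu - v/t is a subgradient of g at A x + v. With convexity of g this makes the merit
   function drop by eta (|d|^2 + |v|^2) / t up to O(eta^2 |d|^2) and O(eta Delta_k) along x + eta d.
   The correction step changes F by at most tau M_1 |h(y)| and, by the eigenvalue bounds on
   J_h J_h^T, lowers |h| by about tau C_1 |h(y)|, so that alpha > M_1 / C_1 gives a net decrease once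
   tau is small. Steps and multipliers are bounded uniformly in k, so a single trial index is
   accepted at every iteration that reaches it. Hence eta_k and tau_k stay away from 0, and summing
   the decreases forces d_k, v_k and h(y_k) to 0. The optimality conditions pass to the limit along
   a subsequence on which the multipliers converge as well. *)
theory Submission
  imports Defs
begin

text \<open>The bounds \<open>lf\<close>, \<open>lA\<close>, \<open>C1\<close>, \<open>C2\<close>
  hold only in the tube of radius 2\<theta>. The test |h(x)| \<le> \<theta>/\<kappa> keeps all
  iterates in the tube of radius \<theta>; the margin \<theta> absorbs the move \<eta> d and,
  separately, the gradient correction. The obstacle is the uniform bound on steps and multipliers,
  since each of them is bounded only in terms of another: lambda by mu, mu by v, and v by an
  estimate containing both multipliers. The circle breaks because |d|^2 + |v|^2 is bounded by an
  affine function of |d| + |v|. The same bound turns the errors \<eta>(\<alpha> + lg + |lambda| +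
  |mu|)\<Delta> into a summable sequence. Two corrections put two demands on \<alpha>. The gradient
  step lowers |h| only in proportion to \<tau>, at a cost of \<tau> M_1 |h(y)| in F, whence M_1/C_1.
  The projection removes |h(y)| entirely, at a cost of at most M_2 |h(y)|, whence M_2. The
  acceptance test asks for half of the drop in |v|^2 and only an \<eta>^2 multiple of |d|^2; the
  first-order drop in |d|^2 pays for every second-order remainder.\<close>

subsection \<open>Gradients, Jacobians and the spectral norm\<close>

text \<open>Final step of a variational argument: after division by the step length
  \<open>s\<close>, the first-order coefficient \<open>a\<close> survives as \<open>s\<close> tends
  to 0.\<close>

lemma nonneg_if_nonneg_perturbed:
  fixes a b :: real
  assumes "\<And>s. 0 < s \<Longrightarrow> s \<le> 1 \<Longrightarrow> 0 \<le> a + s * b"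
  shows "0 \<le> a"
proof (rule tendsto_lowerbound)
  show "((\<lambda>s. a + s * b) \<longlongrightarrow> a) (at_right 0)"
    by (auto intro!: tendsto_eq_intros)
  show "\<forall>\<^sub>F s in at_right 0. 0 \<le> a + s * b"
    unfolding eventually_at_right_field using assms by (intro exI[of _ 1]) auto
qed simp

lemma gradient_eqI: "GDERIV f x :> D \<Longrightarrow> gradient f x = D"
  unfolding gradient_def gderiv_def
proof (rule the_equality, assumption)
  fix E assume "(f has_derivative (\<lambda>h. h \<bullet> D)) (at x)" "(f has_derivative (\<lambda>h. h \<bullet> E)) (at x)"
  then have "(\<lambda>h. h \<bullet> D) = (\<lambda>h. h \<bullet> E)" by (rule has_derivative_unique)
  then show "E = D" by (metis vector_eq_ldot)
qed

text \<open>The Riesz representer of the derivative is its adjoint applied to 1, so the description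
  in \<open>gradient\<close> denotes wherever f is differentiable.\<close>

lemma has_derivative_gradient:
  fixes f :: "'a::euclidean_space \<Rightarrow> real"
  assumes "f differentiable (at z)"
  shows "(f has_derivative (\<lambda>w. gradient f z \<bullet> w)) (at z)"
proof -
  obtain f' where f': "(f has_derivative f') (at z)"
    using assms unfolding differentiable_def by blast
  have "f' w = w \<bullet> adjoint f' 1" for w
    using adjoint_works[OF has_derivative_linear[OF f'], of w 1] by simp
  then have *: "f' = (\<lambda>w. w \<bullet> adjoint f' 1)" by auto
  have "GDERIV f z :> adjoint f' 1"
    using f' * unfolding gderiv_def by metis
  then show ?thesis using gradient_eqI[of f z "adjoint f' 1"] f' * by (simp add: inner_commute)
qed

lemma has_derivative_jac:
  assumes "\<psi> differentiable (at z)"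
  shows "(\<psi> has_derivative (\<lambda>w. jac \<psi> z *v w)) (at z)"
  using assms by (simp add: jacobian_works)

lemma norm_mult_le_spectral: "norm (B *v w) \<le> spectral_norm B * norm w"
  unfolding spectral_norm_def by (intro onorm matrix_vector_mul_bounded_linear)

lemma inner_transpose_mult:
  fixes B :: "real^'n^'m"
  shows "(transpose B *v w) \<bullet> u = w \<bullet> (B *v u)"
  by (simp add: dot_lmul_matrix)

text \<open>Duality: |B^T w|^2 = w . B(B^T w), and one factor |B^T w| cancels.\<close>

lemma norm_transpose_mult_le:
  fixes B :: "real^'n^'m"
  assumes "\<And>u. norm (B *v u) \<le> b * norm u"
  shows "norm (transpose B *v w) \<le> b * norm w"
proof (cases "transpose B *v w = 0")
  case True
  \<comment> \<open>The sign of \<open>b\<close> comes from testing the assumption on an arbitrary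
    coordinate unit vector.\<close>
  have "0 \<le> b" using order_trans[OF norm_ge_zero assms[of "axis undefined 1"]] by simp
  then show ?thesis using True by simp
next
  case False
  have "norm (transpose B *v w) ^ 2 = w \<bullet> (B *v (transpose B *v w))"
    by (simp only: power2_norm_eq_inner inner_transpose_mult)
  also have "\<dots> \<le> norm w * (b * norm (transpose B *v w))"
    by (meson assms norm_cauchy_schwarz norm_ge_zero mult_left_mono order_trans)
  finally show ?thesis using False by (simp add: power2_eq_square mult.commute)
qed

lemma norm_transpose_mult_le_spectral:
  "norm (transpose B *v w) \<le> spectral_norm B * norm w"
  by (rule norm_transpose_mult_le) (rule norm_mult_le_spectral)

text \<open>Mean value inequality on the segment. The constant L in place of the sharp L/2 is
  enough, since remainders are beaten by taking steps small; the absolute value spares an argument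
  that L is nonnegative.\<close>

lemma jac_linearization_bound:
  fixes \<psi> :: "real^'n \<Rightarrow> real^'m"
  assumes diff: "\<And>z. \<psi> differentiable (at z)"
    and lip: "\<And>z w. spectral_norm (jac \<psi> z - jac \<psi> w) \<le> L * norm (z - w)"
  shows "norm (\<psi> (z + w) - \<psi> z - jac \<psi> z *v w) \<le> \<bar>L\<bar> * (norm w)\<^sup>2"
proof -
  have "norm (\<psi> (z + w) - \<psi> z - jac \<psi> z *v (z + w - z)) \<le> norm (z + w - z) * (\<bar>L\<bar> * norm w)"
  proof (rule differentiable_bound_linearization[where S = "closed_segment z (z + w)"
        and f' = "\<lambda>u. (*v) (jac \<psi> u)"])
    show "z + s *\<^sub>R (z + w - z) \<in> closed_segment z (z + w)" if "s \<in> {0..1}" for s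
      using that by (auto simp: closed_segment_def algebra_simps intro!: exI[of _ s])
    show "(\<psi> has_derivative (*v) (jac \<psi> u)) (at u within closed_segment z (z + w))" for u
      using has_derivative_jac[OF diff] by (rule has_derivative_at_withinI)
    show "onorm ((*v) (jac \<psi> u) - (*v) (jac \<psi> z)) \<le> \<bar>L\<bar> * norm w"
      if u: "u \<in> closed_segment z (z + w)" for u
    proof -
      have "(*v) (jac \<psi> u) - (*v) (jac \<psi> z) = (*v) (jac \<psi> u - jac \<psi> z)"
        by (auto simp: fun_eq_iff matrix_vector_mult_diff_rdistrib)
      then have "onorm ((*v) (jac \<psi> u) - (*v) (jac \<psi> z)) \<le> L * norm (u - z)"
        using lip[of u z] by (simp add: spectral_norm_def)
      also have "\<dots> \<le> \<bar>L\<bar> * norm w"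
        using segment_bound(1)[OF u] by (intro mult_mono) auto
      finally show ?thesis .
    qed
  qed auto
  then show ?thesis by (simp add: power2_eq_square mult_ac)
qed

lemma gradient_linearization_bound:
  fixes f :: "'a::euclidean_space \<Rightarrow> real"
  assumes diff: "\<And>z. f differentiable (at z)"
    and lip: "L-lipschitz_on UNIV (gradient f)"
  shows "\<bar>f (z + w) - f z - gradient f z \<bullet> w\<bar> \<le> L * (norm w)\<^sup>2"
proof -
  have L: "0 \<le> L" using lip by (rule lipschitz_on_nonneg)
  have "norm (f (z + w) - f z - gradient f z \<bullet> (z + w - z)) \<le> norm (z + w - z) * (L * norm w)"
  proof (rule differentiable_bound_linearization[where S = "closed_segment z (z + w)"
        and f' = "\<lambda>u. (\<bullet>) (gradient f u)"])
    show "z + s *\<^sub>R (z + w - z) \<in> closed_segment z (z + w)" if "s \<in> {0..1}" for s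
      using that by (auto simp: closed_segment_def algebra_simps intro!: exI[of _ s])
    show "(f has_derivative (\<bullet>) (gradient f u)) (at u within closed_segment z (z + w))" for u
      using has_derivative_gradient[OF diff] by (rule has_derivative_at_withinI)
    show "onorm ((\<bullet>) (gradient f u) - (\<bullet>) (gradient f z)) \<le> L * norm w"
      if u: "u \<in> closed_segment z (z + w)" for u
    proof (rule onorm_le)
      fix q
      have "norm (((\<bullet>) (gradient f u) - (\<bullet>) (gradient f z)) q)
          \<le> norm (gradient f u - gradient f z) * norm q"
        by (simp add: inner_diff_left[symmetric] Cauchy_Schwarz_ineq2)
      also have "\<dots> \<le> (L * norm w) * norm q"
      proof (rule mult_right_mono)
        have "norm (gradient f u - gradient f z) \<le> L * norm (u - z)"
          using lipschitz_onD[OF lip, of u z] by (simp add: dist_norm)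
        also have "\<dots> \<le> L * norm w"
          using segment_bound(1)[OF u] L by (intro mult_left_mono) auto
        finally show "norm (gradient f u - gradient f z) \<le> L * norm w" .
      qed simp
      finally show "norm (((\<bullet>) (gradient f u) - (\<bullet>) (gradient f z)) q) \<le> (L * norm w) * norm q" .
    qed
  qed auto
  then show ?thesis by (simp add: power2_eq_square mult_ac)
qed

lemma gradient_infeasibility:
  assumes "h differentiable (at z)"
  shows "gradient (infeasibility h) z = transpose (jac h z) *v h z"
proof (rule gradient_eqI)
  have "((\<lambda>z. 1 / 2 * (h z \<bullet> h z)) has_derivative
      (\<lambda>w. 1 / 2 * (h z \<bullet> (jac h z *v w) + (jac h z *v w) \<bullet> h z))) (at z)"
    using has_derivative_jac[OF assms] by (intro derivative_intros)
  moreover have "infeasibility h = (\<lambda>z. 1 / 2 * (h z \<bullet> h z))"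
    by (auto simp: infeasibility_def power2_norm_eq_inner)
  moreover have "1 / 2 * (h z \<bullet> (jac h z *v w) + (jac h z *v w) \<bullet> h z)
      = w \<bullet> (transpose (jac h z) *v h z)" for w
    unfolding inner_commute[of w] inner_transpose_mult by (simp add: inner_commute)
  ultimately show "GDERIV (infeasibility h) z :> transpose (jac h z) *v h z"
    unfolding gderiv_def by simp
qed

text \<open>The quadratic form of \<open>e I - B\<close> is nonnegative and vanishes at \<open>w\<close>, so its derivative vanishes there.\<close>

lemma is_eigenvalue_if_form_bound_attained:
  fixes B :: "real^'m^'m"
  assumes sym: "transpose B = B" and w: "w \<noteq> 0" "w \<bullet> (B *v w) = e * (w \<bullet> w)"
    and bound: "\<And>u. u \<bullet> (B *v u) \<le> e * (u \<bullet> u)"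
  shows "is_eigenvalue B e"
proof -
  \<comment> \<open>\<open>r\<close> is half the gradient at \<open>w\<close> of u -> e |u|^2 - u .
    Bu; the form is then probed along the line through \<open>w\<close> in direction
    \<open>r\<close>.\<close>
  define r where "r = e *\<^sub>R w - B *v w"
  define q where "q = e * (r \<bullet> r) - r \<bullet> (B *v r)"
  have sw: "w \<bullet> (B *v r) = r \<bullet> (B *v w)"
    using inner_transpose_mult[of B w r] unfolding sym by (simp only: inner_commute)
  have rr: "e * (w \<bullet> r) - r \<bullet> (B *v w) = r \<bullet> r"
    unfolding r_def[symmetric] inner_commute[of w] by (simp add: r_def inner_diff_right)
  have "0 \<le> 2 * s * (r \<bullet> r) + s\<^sup>2 * q" for s
  proof -
    have "0 \<le> e * ((w + s *\<^sub>R r) \<bullet> (w + s *\<^sub>R r)) - (w + s *\<^sub>R r) \<bullet> (B *v (w + s *\<^sub>R r))"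
      using bound[of "w + s *\<^sub>R r"] by simp
    also have "\<dots> = 2 * s * (e * (w \<bullet> r) - r \<bullet> (B *v w)) + s\<^sup>2 * q"
    proof -
      have "(w + s *\<^sub>R r) \<bullet> (B *v (w + s *\<^sub>R r))
          = e * (w \<bullet> w) + 2 * s * (r \<bullet> (B *v w)) + s\<^sup>2 * (r \<bullet> (B *v r))"
        by (simp add: matrix_vector_right_distrib matrix_vector_mult_scaleR inner_add_left
            inner_add_right power2_eq_square sw w(2) algebra_simps)
      moreover have "(w + s *\<^sub>R r) \<bullet> (w + s *\<^sub>R r) = w \<bullet> w + 2 * s * (w \<bullet> r) + s\<^sup>2 * (r \<bullet> r)"
        by (simp add: inner_add_left inner_add_right power2_eq_square inner_commute[of r w] algebra_simps)
      ultimately show ?thesis by (simp add: q_def algebra_simps)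
    qed
    finally show ?thesis by (simp add: rr)
  qed note quad = this
  \<comment> \<open>A move against \<open>r\<close> would make the form negative to first order
    unless \<open>r\<close> is 0.\<close>
  have "0 \<le> - 2 * (r \<bullet> r) + s * q" if "0 < s" for s
  proof -
    have "0 \<le> s * (- 2 * (r \<bullet> r) + s * q)"
      using quad[of "- s"] by (simp add: algebra_simps power2_eq_square)
    then show ?thesis using that by (simp add: zero_le_mult_iff)
  qed
  then have "0 \<le> - 2 * (r \<bullet> r)" by (rule nonneg_if_nonneg_perturbed)
  then have "r \<bullet> r = 0" using inner_ge_zero[of r] by linarith
  then show ?thesis using w(1) unfolding is_eigenvalue_def r_def by auto
qed

text \<open>Rayleigh: the form attains its maximum on the compact unit sphere, and homogeneity
  carries the bound to all vectors.\<close>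

lemma obtain_max_form_eigenvalue:
  fixes B :: "real^'m^'m"
  assumes "transpose B = B"
  obtains e where "is_eigenvalue B e" "\<And>u. u \<bullet> (B *v u) \<le> e * (u \<bullet> u)"
proof -
  have "continuous_on (sphere 0 1) (\<lambda>u. u \<bullet> (B *v u))"
    by (intro continuous_intros linear_continuous_on matrix_vector_mul_bounded_linear)
  then obtain w where w: "w \<in> sphere 0 1" "\<And>u. u \<in> sphere 0 1 \<Longrightarrow> u \<bullet> (B *v u) \<le> w \<bullet> (B *v w)"
    using continuous_attains_sup[of "sphere (0::real^'m) 1" "\<lambda>u. u \<bullet> (B *v u)"] by auto
  have bound: "u \<bullet> (B *v u) \<le> (w \<bullet> (B *v w)) * (u \<bullet> u)" for u
  proof (cases "u = 0")
    case False
    have "sgn u \<bullet> (B *v sgn u) \<le> w \<bullet> (B *v w)"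
      using False by (intro w(2)) (simp add: norm_sgn)
    then show ?thesis using False
      by (simp add: sgn_div_norm matrix_vector_mult_scaleR field_simps power2_norm_eq_inner
          flip: power2_eq_square)
  qed auto
  have "w \<noteq> 0" "w \<bullet> (B *v w) = (w \<bullet> (B *v w)) * (w \<bullet> w)"
    using w(1) by (auto simp flip: power2_norm_eq_inner)
  then show thesis
    using is_eigenvalue_if_form_bound_attained[OF assms _ _ bound] bound that by blast
qed

text \<open>The assumptions speak of eigenvalues only, while the estimates need norms; the link is u
  . (B B^T)u = |B^T u|^2.\<close>

lemma gram_form_bounds:
  fixes B :: "real^'n^'m"
  assumes "\<And>e. is_eigenvalue (B ** transpose B) e \<Longrightarrow> c \<le> e \<and> e \<le> C"
  shows "c * (norm u)\<^sup>2 \<le> (norm (transpose B *v u))\<^sup>2"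
    and "(norm (transpose B *v u))\<^sup>2 \<le> C * (norm u)\<^sup>2"
proof -
  let ?G = "B ** transpose B"
  have sym: "transpose ?G = ?G" by (simp add: matrix_transpose_mul)
  then have symn: "transpose (- ?G) = - ?G" by (simp add: transpose_def vec_eq_iff)
  have form: "u \<bullet> (?G *v u) = (norm (transpose B *v u))\<^sup>2" for u
    by (simp only: power2_norm_eq_inner inner_transpose_mult matrix_vector_mul_assoc[symmetric])
  have neg: "(- ?G) *v u = - (?G *v u)" for u
    using matrix_vector_mult_diff_rdistrib[of 0 ?G u] by simp
  obtain e where e: "is_eigenvalue ?G e" "\<And>u. u \<bullet> (?G *v u) \<le> e * (u \<bullet> u)"
    using obtain_max_form_eigenvalue[OF sym] by blast
  show "(norm (transpose B *v u))\<^sup>2 \<le> C * (norm u)\<^sup>2"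
    using e(2)[of u] assms[OF e(1)]
    unfolding form power2_norm_eq_inner[symmetric]
    by (meson mult_right_mono order_trans zero_le_power2)
  \<comment> \<open>The smallest eigenvalue is obtained as the largest one of the negated
    matrix.\<close>
  obtain e where e: "is_eigenvalue (- ?G) e" "\<And>u. u \<bullet> ((- ?G) *v u) \<le> e * (u \<bullet> u)"
    using obtain_max_form_eigenvalue[OF symn] by blast
  have "is_eigenvalue ?G (- e)"
    using e(1) unfolding is_eigenvalue_def neg by (auto simp: minus_equation_iff)
  then have "c \<le> - e" using assms by blast
  then have "c * (norm u)\<^sup>2 \<le> - e * (norm u)\<^sup>2" by (intro mult_right_mono) auto
  also have "\<dots> \<le> (norm (transpose B *v u))\<^sup>2"
    using e(2)[of u] form[of u] by (simp add: neg power2_norm_eq_inner del: transpose_matrix_vector)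
  finally show "c * (norm u)\<^sup>2 \<le> (norm (transpose B *v u))\<^sup>2" .
qed

subsection \<open>Proximal maps and the dual objective\<close>

context
  fixes g :: "'a::euclidean_space \<Rightarrow> real" and t l :: real
  assumes convex: "convex_on UNIV g" and lip: "l-lipschitz_on UNIV g" and t: "0 < t"
begin

text \<open>From distance 2tl on, the quadratic term is at least l |y - x|, the most by which g can
  fall. So a minimizer over the ball of that radius is global.\<close>

lemma prox_objective_attains_min:
  "\<exists>p. is_arg_min (\<lambda>y. g y + 1 / (2 * t) * (norm (y - x))\<^sup>2) (\<lambda>_. True) p"
proof -
  let ?\<phi> = "\<lambda>y. g y + 1 / (2 * t) * (norm (y - x))\<^sup>2"
  have l: "0 \<le> l" using lip by (rule lipschitz_on_nonneg)
  have x: "x \<in> cball x (2 * t * l)" using l t by simp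
  then have ne: "cball x (2 * t * l) \<noteq> {}" by blast
  have cont: "continuous_on (cball x (2 * t * l)) ?\<phi>"
    using lipschitz_on_continuous_on[OF lip] by (intro continuous_intros) (auto intro: continuous_on_subset)
  then obtain p where p: "\<And>y. y \<in> cball x (2 * t * l) \<Longrightarrow> ?\<phi> p \<le> ?\<phi> y"
    using continuous_attains_inf[OF compact_cball ne cont] by blast
  have "?\<phi> p \<le> ?\<phi> y" for y
  proof (cases "y \<in> cball x (2 * t * l)")
    case False
    let ?r = "norm (y - x)"
    have r: "2 * t * l \<le> ?r" using False by (simp add: dist_norm norm_minus_commute)
    have "g x - g y \<le> l * ?r"
      using lipschitz_onD[OF lip, of x y] by (simp add: dist_norm norm_minus_commute)
    moreover have "l * ?r \<le> 1 / (2 * t) * ?r\<^sup>2"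
      using mult_right_mono[OF r, of ?r] t by (simp add: field_simps power2_eq_square)
    ultimately show ?thesis using p[OF x] by simp
  qed (rule p)
  then show ?thesis by (auto simp: is_arg_min_def not_less)
qed

text \<open>Compare \<open>p\<close> with a point slightly towards \<open>y\<close>: convexity
  bounds g there, the square is expanded exactly, and dividing by \<open>s\<close> leaves the
  subgradient inequality in the limit.\<close>

lemma subgradient_if_arg_min:
  assumes p: "is_arg_min (\<lambda>y. g y + 1 / (2 * t) * (norm (y - x))\<^sup>2) (\<lambda>_. True) p"
  shows "(1 / t) *\<^sub>R (x - p) \<in> subdifferential g p"
  unfolding subdifferential_def
proof safe
  fix y
  have "0 \<le> (g y - g p - (1 / t) * ((x - p) \<bullet> (y - p))) + s * ((norm (y - p))\<^sup>2 / (2 * t))"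
    if s: "0 < s" "s \<le> 1" for s
  proof -
    let ?z = "p + s *\<^sub>R (y - p)"
    have z: "?z = (1 - s) *\<^sub>R p + s *\<^sub>R y" by (simp add: algebra_simps)
    have "g p + 1 / (2 * t) * (norm (p - x))\<^sup>2 \<le> g ?z + 1 / (2 * t) * (norm (?z - x))\<^sup>2"
      using p unfolding is_arg_min_def by (meson not_less)
    moreover have "g ?z \<le> (1 - s) * g p + s * g y"
      unfolding z using s by (intro convex_onD[OF convex]) auto
    moreover have "(norm (?z - x))\<^sup>2
        = (norm (p - x))\<^sup>2 + (- 2 * s * ((x - p) \<bullet> (y - p)) + s\<^sup>2 * (norm (y - p))\<^sup>2)"
      unfolding power2_norm_eq_inner
      by (simp add: algebra_simps inner_simps power2_eq_square inner_commute)
    ultimately have "0 \<le> s * (g y - g p) + 1 / (2 * t) *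
        (- 2 * s * ((x - p) \<bullet> (y - p)) + s\<^sup>2 * (norm (y - p))\<^sup>2)"
      using left_diff_distrib[of 1 s "g p"]
      by (simp only: distrib_left[of "1 / (2 * t)"] right_diff_distrib mult_1)
    also have "\<dots> = s * ((g y - g p - (1 / t) * ((x - p) \<bullet> (y - p))) + s * ((norm (y - p))\<^sup>2 / (2 * t)))"
      using t by (simp add: field_simps power2_eq_square)
    finally show ?thesis using s by (simp add: zero_le_mult_iff)
  qed
  then have "0 \<le> g y - g p - (1 / t) * ((x - p) \<bullet> (y - p))"
    by (rule nonneg_if_nonneg_perturbed)
  then show "g p + (1 / t) *\<^sub>R (x - p) \<bullet> (y - p) \<le> g y" by simp
qed

lemma is_arg_min_prox:
  "is_arg_min (\<lambda>y. g y + 1 / (2 * t) * (norm (y - x))\<^sup>2) (\<lambda>_. True) (prox t g x)"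
  unfolding prox_def
proof (rule theI')
  let ?min = "is_arg_min (\<lambda>y. g y + 1 / (2 * t) * (norm (y - x))\<^sup>2) (\<lambda>_. True)"
  \<comment> \<open>Uniqueness by monotonicity: the two subgradient inequalities at \<open>p\<close>
    and \<open>q\<close> add up to |p - q|^2 \<le> 0.\<close>
  have "p = q" if "?min p" "?min q" for p q
  proof -
    have "g q \<ge> g p + (1 / t) *\<^sub>R (x - p) \<bullet> (q - p)" "g p \<ge> g q + (1 / t) *\<^sub>R (x - q) \<bullet> (p - q)"
      using that[THEN subgradient_if_arg_min] unfolding subdifferential_def by blast+
    then have "(1 / t) * ((x - p) \<bullet> (q - p) + (x - q) \<bullet> (p - q)) \<le> 0"
      by (simp add: distrib_left)
    then have "(x - p) \<bullet> (q - p) + (x - q) \<bullet> (p - q) \<le> 0"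
      using t by (simp add: divide_le_0_iff)
    moreover have "(x - p) \<bullet> (q - p) + (x - q) \<bullet> (p - q) = (p - q) \<bullet> (p - q)"
      by (simp add: inner_diff_left inner_diff_right inner_commute)
    ultimately show ?thesis by (metis inner_eq_zero_iff inner_ge_zero order_antisym right_minus_eq)
  qed
  then show "\<exists>!p. ?min p" using prox_objective_attains_min by blast
qed

lemma prox_subgradient: "(1 / t) *\<^sub>R (x - prox t g x) \<in> subdifferential g (prox t g x)"
  by (rule subgradient_if_arg_min) (rule is_arg_min_prox)

lemma moreau_env_eq: "moreau_env g t x = g (prox t g x) + 1 / (2 * t) * (norm (prox t g x - x))\<^sup>2"
  unfolding moreau_env_def using is_arg_min_prox[of x]
  by (intro cInf_eq_minimum) (auto simp: is_arg_min_def not_less)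

lemma moreau_env_le: "moreau_env g t x \<le> g y + 1 / (2 * t) * (norm (y - x))\<^sup>2"
  unfolding moreau_env_eq using is_arg_min_prox[of x] by (auto simp: is_arg_min_def not_less)

text \<open>The linearization error is squeezed between 0 and |w|^2/(2t). Above, the old proximal
  point competes in the minimum at u + w; below, the subgradient inequality at the old proximal
  point is tested at the new one.\<close>

lemma GDERIV_moreau_env: "GDERIV (moreau_env g t) u :> (1 / t) *\<^sub>R (u - prox t g u)"
proof -
  let ?p = "prox t g u"
  have bounds: "0 \<le> moreau_env g t (u + w) - moreau_env g t u - w \<bullet> ((1 / t) *\<^sub>R (u - ?p))"
    "moreau_env g t (u + w) - moreau_env g t u - w \<bullet> ((1 / t) *\<^sub>R (u - ?p)) \<le> (norm w)\<^sup>2 / (2 * t)" for w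
  proof -
    let ?q = "prox t g (u + w)"
    have "(norm (?p - (u + w)))\<^sup>2 = (norm (?p - u))\<^sup>2 + 2 * (w \<bullet> (u - ?p)) + (norm w)\<^sup>2"
      unfolding power2_norm_eq_inner by (simp add: algebra_simps inner_simps inner_commute)
    then have "1 / (2 * t) * (norm (?p - (u + w)))\<^sup>2
        = 1 / (2 * t) * (norm (?p - u))\<^sup>2 + (1 / t) * (w \<bullet> (u - ?p)) + (norm w)\<^sup>2 / (2 * t)"
      using t by (simp add: field_simps)
    then show "moreau_env g t (u + w) - moreau_env g t u - w \<bullet> ((1 / t) *\<^sub>R (u - ?p)) \<le> (norm w)\<^sup>2 / (2 * t)"
      using moreau_env_le[of "u + w" ?p] moreau_env_eq[of u] unfolding inner_scaleR_right by linarith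
    have "g ?q \<ge> g ?p + (1 / t) *\<^sub>R (u - ?p) \<bullet> (?q - ?p)"
      using prox_subgradient unfolding subdifferential_def by blast
    \<comment> \<open>Completing the square leaves |?q - ?p - w|^2, whose sign gives the lower
      bound.\<close>
    moreover have "(norm (?q - (u + w)))\<^sup>2 + 2 * ((u - ?p) \<bullet> (?q - ?p))
        = (norm (?p - u))\<^sup>2 + 2 * (w \<bullet> (u - ?p)) + (norm (?q - ?p - w))\<^sup>2"
      unfolding power2_norm_eq_inner by (simp add: algebra_simps inner_simps inner_commute)
    then have "1 / (2 * t) * (norm (?q - (u + w)))\<^sup>2 + (1 / t) * ((u - ?p) \<bullet> (?q - ?p))
        = 1 / (2 * t) * (norm (?p - u))\<^sup>2 + (1 / t) * (w \<bullet> (u - ?p)) + 1 / (2 * t) * (norm (?q - ?p - w))\<^sup>2"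
      using t by (simp add: field_simps)
    moreover have "0 \<le> 1 / (2 * t) * (norm (?q - ?p - w))\<^sup>2" using t by simp
    ultimately show "0 \<le> moreau_env g t (u + w) - moreau_env g t u - w \<bullet> ((1 / t) *\<^sub>R (u - ?p))"
      unfolding moreau_env_eq inner_scaleR_left inner_scaleR_right by linarith
  qed
  show ?thesis unfolding gderiv_def
  proof (rule has_derivativeI_sandwich[where e = 1 and H = "\<lambda>y. norm (y - u) / (2 * t)"])
    show "bounded_linear (\<lambda>w. w \<bullet> (1 / t) *\<^sub>R (u - ?p))"
      by (rule bounded_linear_inner_left)
    show "((\<lambda>y. norm (y - u) / (2 * t)) \<longlongrightarrow> 0) (at u)"
      using t by (auto intro!: tendsto_eq_intros)
    fix y assume "y \<noteq> u"
    then show "norm (moreau_env g t y - moreau_env g t u - (y - u) \<bullet> (1 / t) *\<^sub>R (u - ?p)) / norm (y - u)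
        \<le> norm (y - u) / (2 * t)"
      using bounds[of "y - u"] t by (simp add: field_simps power2_eq_square)
  qed simp
qed

end

text \<open>Testing the subgradient inequality at \<open>p + s\<close> gives |s|^2 \<le> l
  |s|.\<close>

lemma norm_subgradient_le:
  assumes "l-lipschitz_on UNIV g" "s \<in> subdifferential g p"
  shows "norm s \<le> l"
proof (cases "s = 0")
  case True
  then show ?thesis using lipschitz_on_nonneg[OF assms(1)] by simp
next
  case False
  have "(norm s)\<^sup>2 \<le> g (p + s) - g p"
    using assms(2) unfolding subdifferential_def power2_norm_eq_inner
    by (auto dest: spec[of _ "p + s"])
  also have "\<dots> \<le> l * norm s"
    using lipschitz_onD[OF assms(1), of "p + s" p] by (simp add: dist_norm)
  finally show ?thesis using False by (simp add: power2_eq_square)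
qed

text \<open>In the second component the derivative t m of t/2 |m|^2 cancels against the t m inside A
  x + t m - prox. With d and v as in the algorithm the gradient therefore reads (-J_h d, v - J_A
  d).\<close>

lemma gradient_dual_objective:
  fixes f :: "real^'n \<Rightarrow> real" and A :: "real^'n \<Rightarrow> real^'p" and h :: "real^'n \<Rightarrow> real^'m"
  assumes convex: "convex_on UNIV g" and lip: "L-lipschitz_on UNIV g" and t: "0 < t"
  shows "gradient (dual_objective f g A h t x) (l, m) =
    (t *\<^sub>R (jac h x *v dual_residual f A h x l m),
     t *\<^sub>R (jac A x *v dual_residual f A h x l m) + prox t g (A x + t *\<^sub>R m) - A x)"
proof (rule gradient_eqI)
  let ?H = "jac h x" and ?B = "jac A x" and ?r = "dual_residual f A h x l m"
  let ?u = "A x + t *\<^sub>R m"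
  let ?L = "\<lambda>w :: (real^'m) \<times> (real^'p). transpose ?H *v fst w + transpose ?B *v snd w"
  let ?res = "\<lambda>q. dual_residual f A h x (fst q) (snd q)"
  have lin: "((\<lambda>q. transpose ?H *v fst q) has_derivative (\<lambda>w. transpose ?H *v fst w)) (at (l, m))"
    "((\<lambda>q. transpose ?B *v snd q) has_derivative (\<lambda>w. transpose ?B *v snd w)) (at (l, m))"
    by (intro bounded_linear.has_derivative[OF matrix_vector_mul_bounded_linear]
        has_derivative_fst has_derivative_snd has_derivative_ident)+
  have "(?res has_derivative (\<lambda>w. 0 + (transpose ?H *v fst w) + (transpose ?B *v snd w))) (at (l, m))"
    unfolding dual_residual_def
    by (rule has_derivative_add[OF has_derivative_add[OF has_derivative_const lin(1)] lin(2)])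
  then have res: "(?res has_derivative ?L) (at (l, m))" by (simp only: add_0)
  have "((\<lambda>q. A x + t *\<^sub>R snd q) has_derivative (\<lambda>w. t *\<^sub>R snd w)) (at (l, m))"
    by (auto intro!: derivative_eq_intros)
  then have env: "((\<lambda>q. moreau_env g t (A x + t *\<^sub>R snd q)) has_derivative
      (\<lambda>w. (t *\<^sub>R snd w) \<bullet> ((1 / t) *\<^sub>R (?u - prox t g ?u)))) (at (l, m))"
    using GDERIV_moreau_env[OF convex lip t, of ?u] unfolding gderiv_def
    by (intro has_derivative_compose[where f = "\<lambda>q. A x + t *\<^sub>R snd q" and g = "moreau_env g t"]) auto
  have "((\<lambda>q. t / 2 * (?res q \<bullet> ?res q) + t / 2 * (snd q \<bullet> snd q) - moreau_env g t (A x + t *\<^sub>R snd q))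
      has_derivative (\<lambda>w. t / 2 * (?res (l, m) \<bullet> ?L w + ?L w \<bullet> ?res (l, m))
        + t / 2 * (snd (l, m) \<bullet> snd w + snd w \<bullet> snd (l, m))
        - (t *\<^sub>R snd w) \<bullet> ((1 / t) *\<^sub>R (?u - prox t g ?u)))) (at (l, m))"
    by (intro has_derivative_diff has_derivative_add has_derivative_mult_right has_derivative_inner
        res env has_derivative_snd has_derivative_ident)
  moreover have "dual_objective f g A h t x = (\<lambda>q. t / 2 * (?res q \<bullet> ?res q)
      + t / 2 * (snd q \<bullet> snd q) - moreau_env g t (A x + t *\<^sub>R snd q))"
    by (auto simp: dual_objective_def power2_norm_eq_inner)
  moreover have "t / 2 * (?res (l, m) \<bullet> ?L w + ?L w \<bullet> ?res (l, m))
        + t / 2 * (snd (l, m) \<bullet> snd w + snd w \<bullet> snd (l, m))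
        - (t *\<^sub>R snd w) \<bullet> ((1 / t) *\<^sub>R (?u - prox t g ?u))
      = w \<bullet> (t *\<^sub>R (?H *v ?r), t *\<^sub>R (?B *v ?r) + prox t g ?u - A x)" for w
  proof -
    have "?L w \<bullet> ?r = fst w \<bullet> (?H *v ?r) + snd w \<bullet> (?B *v ?r)"
      by (simp only: inner_add_left inner_transpose_mult)
    moreover have "(t *\<^sub>R snd w) \<bullet> ((1 / t) *\<^sub>R (?u - prox t g ?u)) = snd w \<bullet> (?u - prox t g ?u)"
      using t by simp
    ultimately show ?thesis
      unfolding inner_commute[of "?res (l, m)"] inner_commute[of "snd (l, m)"]
      by (simp add: inner_prod_def inner_add_right inner_diff_right algebra_simps)
  qed
  ultimately show "GDERIV (dual_objective f g A h t x) (l, m) :>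
      (t *\<^sub>R (?H *v ?r), t *\<^sub>R (?B *v ?r) + prox t g ?u - A x)"
    unfolding gderiv_def by (simp only:)
qed

text \<open>All that the analysis uses of one outer iteration, without proximal map, dual objective
  or iteration index; statements that quantify over it are uniform in k by their form.\<close>

definition inexact_dual_step ::
  "(real^'n \<Rightarrow> real) \<Rightarrow> (real^'p \<Rightarrow> real) \<Rightarrow> (real^'n \<Rightarrow> real^'p) \<Rightarrow> (real^'n \<Rightarrow> real^'m) \<Rightarrow>
    real \<Rightarrow> real \<Rightarrow> real^'n \<Rightarrow> real^'m \<Rightarrow> real^'p \<Rightarrow> real^'n \<Rightarrow> real^'p \<Rightarrow> bool" where
  "inexact_dual_step f g A h t \<Delta> x l m d v \<longleftrightarrow>
    d = - t *\<^sub>R dual_residual f A h x l m \<and>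
    norm (jac h x *v d) \<le> \<Delta> \<and>
    norm (v - jac A x *v d) \<le> \<Delta> \<and>
    m - (1 / t) *\<^sub>R v \<in> subdifferential g (A x + v)"

lemma inexact_dual_step_if_gradient_small:
  fixes f :: "real^'n \<Rightarrow> real" and A :: "real^'n \<Rightarrow> real^'p" and h :: "real^'n \<Rightarrow> real^'m"
  assumes convex: "convex_on UNIV g" and lip: "L-lipschitz_on UNIV g" and t: "0 < t"
    and small: "norm (gradient (dual_objective f g A h t x) (l, m)) \<le> \<Delta>"
    and d: "d = - t *\<^sub>R dual_residual f A h x l m"
    and v: "v = prox t g (A x + t *\<^sub>R m) - A x"
  shows "inexact_dual_step f g A h t \<Delta> x l m d v"
  unfolding inexact_dual_step_def
proof (intro conjI d)
  have Bd: "B *v d = - (t *\<^sub>R (B *v dual_residual f A h x l m))" for B :: "real^'n^'k"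
    unfolding d by (metis matrix_vector_mult_scaleR scaleR_minus_left)
  have grad: "gradient (dual_objective f g A h t x) (l, m) = (- (jac h x *v d), v - jac A x *v d)"
    unfolding gradient_dual_objective[OF convex lip t] Bd v by simp
  show "norm (jac h x *v d) \<le> \<Delta>" "norm (v - jac A x *v d) \<le> \<Delta>"
    using small norm_fst_le[of "- (jac h x *v d)" "v - jac A x *v d"]
      norm_snd_le[of "v - jac A x *v d" "- (jac h x *v d)"]
    unfolding grad norm_minus_cancel by linarith+
  have "m - (1 / t) *\<^sub>R v = (1 / t) *\<^sub>R (A x + t *\<^sub>R m - prox t g (A x + t *\<^sub>R m))"
    using t by (simp add: v algebra_simps)
  then show "m - (1 / t) *\<^sub>R v \<in> subdifferential g (A x + v)"
    using prox_subgradient[OF convex lip t, of "A x + t *\<^sub>R m"] by (simp add: v)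
qed

subsection \<open>Sequences and limits\<close>

lemma eventually_at_right_mult_less:
  fixes a b :: real
  assumes "0 < b"
  shows "\<forall>\<^sub>F s in at_right 0. a * s < b"
proof (rule order_tendstoD(2))
  show "((\<lambda>s. a * s) \<longlongrightarrow> 0) (at_right 0)" by (auto intro!: tendsto_eq_intros)
qed (rule assms)

text \<open>Breaks the circular bounds on steps and multipliers: for s > a + b + 1 the product (a +
  b + 1)s already exceeds a s + b.\<close>

lemma le_if_square_le_affine:
  fixes a b s :: real
  assumes "s\<^sup>2 \<le> a * s + b" "0 \<le> a" "0 \<le> b"
  shows "s \<le> a + b + 1"
proof (rule ccontr)
  assume "\<not> s \<le> a + b + 1"
  then have s: "a + b + 1 < s" by simp
  then have "(a + b + 1) * s < s * s" using assms(2,3) by (intro mult_strict_right_mono) auto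
  moreover have "b * 1 \<le> b * s" using s assms(2,3) by (intro mult_left_mono) auto
  ultimately show False using assms(1) s assms(2,3) by (simp add: power2_eq_square algebra_simps)
qed

text \<open>Telescoping bounds every partial sum of \<open>a\<close> by \<Phi> 0 - c plus the total
  error.\<close>

lemma summable_decrease:
  fixes \<Phi> a e :: "nat \<Rightarrow> real"
  assumes "\<And>k. \<Phi> (Suc k) \<le> \<Phi> k - a k + e k" "\<And>k. 0 \<le> a k" "\<And>k. 0 \<le> e k" "summable e"
    "\<And>k. c \<le> \<Phi> k"
  shows "summable a"
proof (rule summableI_nonneg_bounded[OF assms(2)])
  fix n
  have "sum a {..<n} \<le> \<Phi> 0 - \<Phi> n + sum e {..<n}"
  proof (induction n)
    case (Suc n)
    then show ?case using assms(1)[of n] by simp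
  qed simp
  then show "sum a {..<n} \<le> \<Phi> 0 - c + suminf e"
    using assms(5)[of n] sum_le_suminf[OF assms(4) finite_lessThan, of n] assms(3) by fastforce
qed

text \<open>The exponent lets one lemma serve d and v, whose squared norms are summable, and h(y),
  whose norm itself is.\<close>

lemma tendsto_zero_if_scaled_norm_power_le:
  fixes u :: "nat \<Rightarrow> 'a::real_normed_vector" and a :: "nat \<Rightarrow> real"
  assumes "a \<longlonglongrightarrow> 0" "0 < c" "\<And>k. c * norm (u k) ^ n \<le> a k" "0 < n"
  shows "u \<longlonglongrightarrow> 0"
proof -
  have "(\<lambda>k. a k / c) \<longlonglongrightarrow> 0"
    using tendsto_divide[OF assms(1) tendsto_const, of c] assms(2) by simp
  then have "(\<lambda>k. norm (u k) ^ n) \<longlonglongrightarrow> 0"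
  proof (rule Lim_null_comparison[rotated])
    show "\<forall>\<^sub>F k in sequentially. norm (norm (u k) ^ n) \<le> a k / c"
      using assms(2,3) by (auto simp: field_simps)
  qed
  then have "(\<lambda>k. root n (norm (u k) ^ n)) \<longlonglongrightarrow> root n 0"
    by (rule tendsto_real_root)
  then show ?thesis
    using assms(4) by (simp add: real_root_power_cancel tendsto_norm_zero_iff)
qed

text \<open>Splitting into a change of matrix and a change of vector allows a direct use of the
  spectral Lipschitz bound, without going through the Frobenius norm of the matrix type.\<close>

lemma tendsto_transpose_jac_mult:
  fixes \<psi> :: "real^'n \<Rightarrow> real^'m"
  assumes lip: "\<And>z w. spectral_norm (jac \<psi> z - jac \<psi> w) \<le> L * norm (z - w)"
    and X: "X \<longlonglongrightarrow> z" and u: "u \<longlonglongrightarrow> w"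
  shows "(\<lambda>k. transpose (jac \<psi> (X k)) *v u k) \<longlonglongrightarrow> transpose (jac \<psi> z) *v w"
proof -
  have split: "transpose (jac \<psi> (X k)) *v u k - transpose (jac \<psi> z) *v w
      = transpose (jac \<psi> (X k) - jac \<psi> z) *v u k + transpose (jac \<psi> z) *v (u k - w)" for k
  proof -
    have "transpose (jac \<psi> (X k) - jac \<psi> z) = transpose (jac \<psi> (X k)) - transpose (jac \<psi> z)"
      by (simp add: transpose_def vec_eq_iff)
    then show ?thesis
      by (simp only: matrix_vector_mult_diff_rdistrib matrix_vector_mult_diff_distrib) simp
  qed
  have "(\<lambda>k. transpose (jac \<psi> (X k)) *v u k - transpose (jac \<psi> z) *v w) \<longlonglongrightarrow> 0"
  proof (rule Lim_null_comparison)
    show "\<forall>\<^sub>F k in sequentially. norm (transpose (jac \<psi> (X k)) *v u k - transpose (jac \<psi> z) *v w)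
        \<le> L * norm (X k - z) * norm (u k) + spectral_norm (jac \<psi> z) * norm (u k - w)"
    proof (rule always_eventually, rule allI)
      fix k
      have "norm (transpose (jac \<psi> (X k) - jac \<psi> z) *v u k) \<le> L * norm (X k - z) * norm (u k)"
        using norm_transpose_mult_le_spectral lip by (meson mult_right_mono norm_ge_zero order_trans)
      then show "norm (transpose (jac \<psi> (X k)) *v u k - transpose (jac \<psi> z) *v w)
          \<le> L * norm (X k - z) * norm (u k) + spectral_norm (jac \<psi> z) * norm (u k - w)"
        unfolding split
        using norm_triangle_le add_mono norm_transpose_mult_le_spectral by blast
    qed
    have "(\<lambda>k. norm (X k - z)) \<longlonglongrightarrow> 0" "(\<lambda>k. norm (u k - w)) \<longlonglongrightarrow> 0"
      using X u by (simp_all add: LIM_zero tendsto_norm_zero)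
    then have "(\<lambda>k. L * norm (X k - z) * norm (u k) + spectral_norm (jac \<psi> z) * norm (u k - w))
        \<longlonglongrightarrow> L * 0 * norm w + spectral_norm (jac \<psi> z) * 0"
      by (intro tendsto_add tendsto_mult tendsto_const tendsto_norm[OF u])
    then show "(\<lambda>k. L * norm (X k - z) * norm (u k) + spectral_norm (jac \<psi> z) * norm (u k - w)) \<longlonglongrightarrow> 0"
      by simp
  qed
  then show ?thesis by (rule LIM_zero_cancel)
qed

lemma filterlim_geometric_at_right_0:
  fixes c q :: real
  assumes "0 < c" "0 < q" "q < 1"
  shows "filterlim (\<lambda>j. c * q ^ j) (at_right 0) sequentially"
proof (rule tendsto_imp_filterlim_at_right)
  show "(\<lambda>j. c * q ^ j) \<longlonglongrightarrow> 0"
    using assms by (auto intro!: tendsto_mult_right_zero LIMSEQ_power_zero)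
qed (use assms in simp)

subsection \<open>Descent of the merit function\<close>

locale composite_problem =
  fixes f :: "real^'n \<Rightarrow> real" and g :: "real^'p \<Rightarrow> real"
    and A :: "real^'n \<Rightarrow> real^'p" and h :: "real^'n \<Rightarrow> real^'m"
    and M :: "(real^'n) set"
    and \<kappa> \<theta> C1 C2 Lh Lf LA lg lf lA :: real
  assumes M_compact: "compact M" and M_nonempty: "M \<noteq> {}" and M_eq: "M = {z. h z = 0}"
    and f_diff: "\<And>z. f differentiable (at z)"
    and A_diff: "\<And>z. A differentiable (at z)"
    and h_diff: "\<And>z. h differentiable (at z)"
    and g_convex: "convex_on UNIV g"
    and kappa: "\<kappa> > 0" "\<And>z. infdist z M \<le> \<kappa> * norm (h z)"
    and h_lip: "Lh > 0" "\<And>z w. spectral_norm (jac h z - jac h w) \<le> Lh * norm (z - w)"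
    and h_eig: "\<theta> > 0" "0 < C1" "C1 \<le> C2"
      "\<And>z e. z \<in> tube M (2 * \<theta>) \<Longrightarrow> is_eigenvalue (jac h z ** transpose (jac h z)) e \<Longrightarrow>
          C1 \<le> e \<and> e \<le> C2"
    and f_lip: "Lf-lipschitz_on UNIV (gradient f)"
    and g_lip: "lg-lipschitz_on UNIV g"
    and A_lip: "\<And>z w. spectral_norm (jac A z - jac A w) \<le> LA * norm (z - w)"
    and lf: "lf > 0" "\<And>z. z \<in> tube M (2 * \<theta>) \<Longrightarrow> norm (gradient f z) \<le> lf"
    and lA: "lA > 0" "\<And>z. z \<in> tube M (2 * \<theta>) \<Longrightarrow> spectral_norm (jac A z) \<le> lA"
begin

lemma lg_nonneg: "0 \<le> lg"
  using g_lip by (rule lipschitz_on_nonneg)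

lemma g_diff_le: "\<bar>g u - g w\<bar> \<le> lg * norm (u - w)"
  using lipschitz_onD[OF g_lip, of u w] by (simp add: dist_norm)

lemma norm_transpose_jac_h:
  assumes "z \<in> tube M (2 * \<theta>)"
  shows "C1 * (norm u)\<^sup>2 \<le> (norm (transpose (jac h z) *v u))\<^sup>2"
    and "sqrt C1 * norm u \<le> norm (transpose (jac h z) *v u)"
    and "norm (transpose (jac h z) *v u) \<le> sqrt C2 * norm u"
    and "norm (jac h z *v w) \<le> sqrt C2 * norm w"
proof -
  note bounds = gram_form_bounds[of "jac h z" C1 C2, OF h_eig(4)[OF assms]]
  show "C1 * (norm u)\<^sup>2 \<le> (norm (transpose (jac h z) *v u))\<^sup>2"
    using bounds(1) by blast
  then have "sqrt (C1 * (norm u)\<^sup>2) \<le> norm (transpose (jac h z) *v u)"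
    by (rule real_le_lsqrt[OF norm_ge_zero])
  then show "sqrt C1 * norm u \<le> norm (transpose (jac h z) *v u)"
    by (simp add: real_sqrt_mult)
  have upper: "norm (transpose (jac h z) *v u) \<le> sqrt C2 * norm u" for u
    using real_le_rsqrt[OF bounds(2)[of u]] by (simp add: real_sqrt_mult)
  then show "norm (transpose (jac h z) *v u) \<le> sqrt C2 * norm u" .
  show "norm (jac h z *v w) \<le> sqrt C2 * norm w"
    using norm_transpose_mult_le[of "transpose (jac h z)" "sqrt C2" w] upper
    by (simp only: transpose_transpose)
qed

text \<open>Mean value inequality; the segment must stay in the tube, where the derivative bounds
  hold. The factor is the one common to M_1 and M_2.\<close>

lemma objective_diff_le:
  assumes "closed_segment y z \<subseteq> tube M (2 * \<theta>)"
  shows "\<bar>objective f g A z - objective f g A y\<bar> \<le> (lf + lg * lA) * norm (z - y)"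
proof -
  have "norm (f z - f y) \<le> lf * norm (z - y)"
  proof (rule differentiable_bound[where S = "closed_segment y z"])
    show "(f has_derivative (\<bullet>) (gradient f u)) (at u within closed_segment y z)" for u
      using has_derivative_gradient[OF f_diff] by (rule has_derivative_at_withinI)
    show "onorm ((\<bullet>) (gradient f u)) \<le> lf" if "u \<in> closed_segment y z" for u
    proof (rule onorm_le)
      fix w
      have "norm (gradient f u \<bullet> w) \<le> norm (gradient f u) * norm w"
        by (simp add: Cauchy_Schwarz_ineq2)
      also have "\<dots> \<le> lf * norm w"
        using lf(2) that assms by (intro mult_right_mono) auto
      finally show "norm (gradient f u \<bullet> w) \<le> lf * norm w" .
    qed
  qed auto
  moreover have "norm (A z - A y) \<le> lA * norm (z - y)"
  proof (rule differentiable_bound[where S = "closed_segment y z"])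
    show "(A has_derivative (*v) (jac A u)) (at u within closed_segment y z)" for u
      using has_derivative_jac[OF A_diff] by (rule has_derivative_at_withinI)
    show "onorm ((*v) (jac A u)) \<le> lA" if "u \<in> closed_segment y z" for u
      using lA(2)[of u] that assms unfolding spectral_norm_def by auto
  qed auto
  then have "\<bar>g (A z) - g (A y)\<bar> \<le> lg * (lA * norm (z - y))"
    using g_diff_le lg_nonneg by (meson mult_left_mono order_trans)
  ultimately show ?thesis
    unfolding objective_def by (simp add: algebra_simps)
qed

text \<open>Pairing the residual -d/t with d moves the transposes over: they act as J_h d, which is
  small, and J_A d, which is close to v.\<close>

lemma inexact_dual_step_inner:
  assumes "inexact_dual_step f g A h t \<Delta> x l m d v" "0 < t"
  shows "gradient f x \<bullet> d + l \<bullet> (jac h x *v d) + m \<bullet> (jac A x *v d) = - (1 / t) * (norm d)\<^sup>2"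
proof -
  have "dual_residual f A h x l m = - (1 / t) *\<^sub>R d"
    using assms by (simp add: inexact_dual_step_def)
  then have "dual_residual f A h x l m \<bullet> d = - (1 / t) * (norm d)\<^sup>2"
    by (simp add: power2_norm_eq_inner)
  then show ?thesis
    by (simp only: dual_residual_def inner_add_left inner_transpose_mult)
qed

text \<open>f and h are linearized along d, but g is controlled along v by convexity, which is why
  \<eta> \<le> 1. The resulting m . v replaces m . J_A d in the dual identity at a cost of |m|
  \<Delta>.\<close>

lemma merit_full_step_le:
  assumes step: "inexact_dual_step f g A h t \<Delta> x l m d v"
    and t: "0 < t" and \<alpha>: "0 < \<alpha>" and \<eta>: "0 \<le> \<eta>" "\<eta> \<le> 1"
  shows "merit f g A h \<alpha> (x + \<eta> *\<^sub>R d) \<le> merit f g A h \<alpha> x - \<eta> / t * (norm d)\<^sup>2 - \<eta> / t * (norm v)\<^sup>2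
    + \<eta> * (\<alpha> + lg + norm l + norm m) * \<Delta> + (Lf + lg * \<bar>LA\<bar> + \<alpha> * Lh) * \<eta>\<^sup>2 * (norm d)\<^sup>2"
proof -
  let ?H = "jac h x" and ?B = "jac A x" and ?s = "m - (1 / t) *\<^sub>R v"
  have Hd: "norm (?H *v d) \<le> \<Delta>" and Bd: "norm (v - ?B *v d) \<le> \<Delta>"
    and s: "?s \<in> subdifferential g (A x + v)"
    using step unfolding inexact_dual_step_def by auto
  have f_le: "f (x + \<eta> *\<^sub>R d) \<le> f x + \<eta> * (gradient f x \<bullet> d) + Lf * (\<eta>\<^sup>2 * (norm d)\<^sup>2)"
    using gradient_linearization_bound[OF f_diff f_lip, of x "\<eta> *\<^sub>R d"]
    by (simp add: power_mult_distrib)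
  have h_le: "norm (h (x + \<eta> *\<^sub>R d)) \<le> norm (h x) + \<eta> * \<Delta> + Lh * (\<eta>\<^sup>2 * (norm d)\<^sup>2)"
  proof -
    have "norm (h (x + \<eta> *\<^sub>R d) - h x - ?H *v (\<eta> *\<^sub>R d)) \<le> Lh * (\<eta>\<^sup>2 * (norm d)\<^sup>2)"
      using jac_linearization_bound[OF h_diff h_lip(2), of x "\<eta> *\<^sub>R d"] h_lip(1)
      by (simp add: power_mult_distrib)
    moreover have "norm (?H *v (\<eta> *\<^sub>R d)) \<le> \<eta> * \<Delta>"
      using Hd \<eta> by (simp add: matrix_vector_mult_scaleR mult_left_mono)
    moreover have "norm a \<le> norm (a - b - c) + norm b + norm c" for a b c :: "real^'m"
      by norm
    ultimately show ?thesis
      by (smt (verit, best))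
  qed
  \<comment> \<open>The reference point is A x + \<eta> v rather than A x + \<eta> J_A d, because it
    lies on the segment from A x to A x + v.\<close>
  have "norm (A (x + \<eta> *\<^sub>R d) - (A x + \<eta> *\<^sub>R v)) \<le> \<eta> * \<Delta> + \<bar>LA\<bar> * (\<eta>\<^sup>2 * (norm d)\<^sup>2)"
  proof -
    have "norm (A (x + \<eta> *\<^sub>R d) - A x - ?B *v (\<eta> *\<^sub>R d)) \<le> \<bar>LA\<bar> * (\<eta>\<^sup>2 * (norm d)\<^sup>2)"
      using jac_linearization_bound[OF A_diff A_lip, of x "\<eta> *\<^sub>R d"]
      by (simp add: power_mult_distrib)
    moreover have "norm (\<eta> *\<^sub>R v - ?B *v (\<eta> *\<^sub>R d)) \<le> \<eta> * \<Delta>"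
      using Bd \<eta> by (simp add: matrix_vector_mult_scaleR mult_left_mono flip: scaleR_diff_right)
    moreover have "norm (a - (b + c)) \<le> norm (a - b - e) + norm (c - e)" for a b c e :: "real^'p"
      by norm
    ultimately show ?thesis
      by (smt (verit, best))
  qed
  then have "\<bar>g (A (x + \<eta> *\<^sub>R d)) - g (A x + \<eta> *\<^sub>R v)\<bar> \<le> lg * (\<eta> * \<Delta> + \<bar>LA\<bar> * (\<eta>\<^sup>2 * (norm d)\<^sup>2))"
    using g_diff_le lg_nonneg by (meson mult_left_mono order_trans)
  moreover have "g (A x + \<eta> *\<^sub>R v) \<le> g (A x) + \<eta> * (g (A x + v) - g (A x))"
  proof -
    have "A x + \<eta> *\<^sub>R v = (1 - \<eta>) *\<^sub>R A x + \<eta> *\<^sub>R (A x + v)" by (simp add: algebra_simps)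
    then have "g (A x + \<eta> *\<^sub>R v) \<le> (1 - \<eta>) * g (A x) + \<eta> * g (A x + v)"
      using convex_onD[OF g_convex, of \<eta> "A x" "A x + v"] \<eta> by simp
    then show ?thesis by (simp add: algebra_simps)
  qed
  \<comment> \<open>The subgradient at the far end A x + v is tested at A x; its part -v/t produces
    the drop |v|^2/t.\<close>
  moreover have "g (A x + v) - g (A x) \<le> ?s \<bullet> v"
    using s unfolding subdifferential_def by (auto dest: spec[of _ "A x"])
  then have "\<eta> * (g (A x + v) - g (A x)) \<le> \<eta> * (m \<bullet> v - (1 / t) * (norm v)\<^sup>2)"
    using \<eta> by (intro mult_left_mono) (auto simp: inner_diff_left power2_norm_eq_inner)
  ultimately have g_le: "g (A (x + \<eta> *\<^sub>R d)) \<le> g (A x) + \<eta> * (m \<bullet> v - (1 / t) * (norm v)\<^sup>2)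
      + lg * (\<eta> * \<Delta> + \<bar>LA\<bar> * (\<eta>\<^sup>2 * (norm d)\<^sup>2))"
    by linarith
  have "gradient f x \<bullet> d + m \<bullet> v \<le> - (1 / t) * (norm d)\<^sup>2 + (norm l + norm m) * \<Delta>"
  proof -
    have "gradient f x \<bullet> d + l \<bullet> (?H *v d) + m \<bullet> (?B *v d) = - (1 / t) * (norm d)\<^sup>2"
      by (rule inexact_dual_step_inner[OF step t])
    moreover have "- (l \<bullet> (?H *v d)) \<le> norm l * \<Delta>"
      using Cauchy_Schwarz_ineq2[of l "?H *v d"] mult_left_mono[OF Hd norm_ge_zero[of l]] by linarith
    moreover have "m \<bullet> v - m \<bullet> (?B *v d) \<le> norm m * \<Delta>"
      using norm_cauchy_schwarz[of m "v - ?B *v d"] mult_left_mono[OF Bd norm_ge_zero[of m]]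
      unfolding inner_diff_right by linarith
    ultimately show ?thesis by (simp add: algebra_simps)
  qed
  then have dual: "\<eta> * (gradient f x \<bullet> d + m \<bullet> v)
      \<le> \<eta> * (- (1 / t) * (norm d)\<^sup>2 + (norm l + norm m) * \<Delta>)"
    using \<eta> by (intro mult_left_mono) auto
  have "\<alpha> * norm (h (x + \<eta> *\<^sub>R d)) \<le> \<alpha> * (norm (h x) + \<eta> * \<Delta> + Lh * (\<eta>\<^sup>2 * (norm d)\<^sup>2))"
    using h_le \<alpha> by (intro mult_left_mono) auto
  then show ?thesis
    using f_le g_le dual unfolding merit_def objective_def
    by (simp add: algebra_simps)
qed

text \<open>Coefficient of \<tau>^2 in the contraction factor of |h|: the first term comes from the
  linearized step, the second from the linearization error of h.\<close>

definition correction_const :: real where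
  "correction_const = C1 * C2 / 2 + Lh * C2 * \<theta> / \<kappa>"

text \<open>The linearized step maps w = h(y) to (I - \<tau> J J^T)w, which the eigenvalue bounds
  contract. The remainder is of order \<tau>^2 |w|^2, and feasibility makes it linear in
  |w|.\<close>

lemma norm_h_gradient_correction_le:
  assumes y: "y \<in> tube M (2 * \<theta>)" and feas: "norm (h y) \<le> \<theta> / \<kappa>"
    and \<tau>: "0 < \<tau>" "C2 * \<tau> < 1"
  shows "norm (h (y - \<tau> *\<^sub>R (transpose (jac h y) *v h y)))
    \<le> (1 - \<tau> * C1 + \<tau>\<^sup>2 * correction_const) * norm (h y)"
proof -
  define w where "w = h y"
  define q where "q = transpose (jac h y) *v w"
  have "C1 * \<tau> \<le> C2 * \<tau>" using h_eig(3) \<tau>(1) by simp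
  then have C1\<tau>: "C1 * \<tau> < 1" using \<tau>(2) by linarith
  have "(norm (w - \<tau> *\<^sub>R (jac h y *v q)))\<^sup>2
      = (norm w)\<^sup>2 - 2 * \<tau> * (norm q)\<^sup>2 + \<tau>\<^sup>2 * (norm (jac h y *v q))\<^sup>2"
  proof -
    have "w \<bullet> (jac h y *v q) = (norm q)\<^sup>2"
      by (simp only: q_def power2_norm_eq_inner inner_transpose_mult)
    moreover have "(norm (a - s *\<^sub>R b))\<^sup>2 = (norm a)\<^sup>2 - 2 * s * (a \<bullet> b) + s\<^sup>2 * (norm b)\<^sup>2"
      for a b :: "real^'m" and s :: real
      unfolding power2_norm_eq_inner
      by (simp add: inner_diff_left inner_diff_right inner_commute power2_eq_square algebra_simps)
    ultimately show ?thesis by simp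
  qed
  also have "\<dots> \<le> (norm w)\<^sup>2 - (2 * \<tau> - C2 * \<tau>\<^sup>2) * (norm q)\<^sup>2"
  proof -
    have "(norm (jac h y *v q))\<^sup>2 \<le> (sqrt C2 * norm q)\<^sup>2"
      using norm_transpose_jac_h(4)[OF y] by (intro power_mono) auto
    then have "(norm (jac h y *v q))\<^sup>2 \<le> C2 * (norm q)\<^sup>2"
      using h_eig(2,3) by (simp add: power_mult_distrib)
    then have "\<tau>\<^sup>2 * (norm (jac h y *v q))\<^sup>2 \<le> \<tau>\<^sup>2 * (C2 * (norm q)\<^sup>2)"
      by (intro mult_left_mono) auto
    then show ?thesis by (simp add: algebra_simps)
  qed
  also have "\<dots> \<le> (norm w)\<^sup>2 - (2 * \<tau> - C2 * \<tau>\<^sup>2) * (C1 * (norm w)\<^sup>2)"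
  proof -
    \<comment> \<open>Keeps the coefficient of |q|^2 of the right sign, so that the lower bound C1
      |w|^2 on |q|^2 may be inserted.\<close>
    have "C2 * \<tau>\<^sup>2 \<le> 1 * \<tau>"
      using \<tau> mult_right_mono[of "C2 * \<tau>" 1 \<tau>] by (simp add: power2_eq_square)
    then have "0 \<le> 2 * \<tau> - C2 * \<tau>\<^sup>2" using \<tau>(1) by simp
    then show ?thesis
      using norm_transpose_jac_h(1)[OF y, of w] unfolding q_def by (simp add: mult_left_mono)
  qed
  also have "\<dots> \<le> ((1 - \<tau> * C1 + \<tau>\<^sup>2 * (C1 * C2 / 2)) * norm w)\<^sup>2"
  proof -
    \<comment> \<open>Adding (?a - ?b)^2 turns 1 - 2 ?a + 2 ?b into a perfect square, so that roots
      can be taken.\<close>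
    let ?a = "\<tau> * C1" and ?b = "\<tau>\<^sup>2 * (C1 * C2 / 2)"
    have "(1 - ?a + ?b)\<^sup>2 = 1 - 2 * ?a + 2 * ?b + (?a - ?b)\<^sup>2"
      by (simp add: power2_eq_square algebra_simps)
    then have "1 - 2 * ?a + 2 * ?b \<le> (1 - ?a + ?b)\<^sup>2" by simp
    then have "(1 - 2 * ?a + 2 * ?b) * (norm w)\<^sup>2 \<le> (1 - ?a + ?b)\<^sup>2 * (norm w)\<^sup>2"
      by (intro mult_right_mono) auto
    then show ?thesis unfolding power_mult_distrib by (simp add: algebra_simps)
  qed
  finally have lin: "norm (w - \<tau> *\<^sub>R (jac h y *v q))
      \<le> (1 - \<tau> * C1 + \<tau>\<^sup>2 * (C1 * C2 / 2)) * norm w"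
  proof (rule power2_le_imp_le)
    have "0 \<le> \<tau>\<^sup>2 * (C1 * C2 / 2)" using h_eig(2,3) by simp
    then show "0 \<le> (1 - \<tau> * C1 + \<tau>\<^sup>2 * (C1 * C2 / 2)) * norm w"
      using C1\<tau> by (intro mult_nonneg_nonneg) (auto simp: mult.commute)
  qed
  have "norm (h (y - \<tau> *\<^sub>R q) - h y - jac h y *v (- \<tau> *\<^sub>R q)) \<le> Lh * (\<tau>\<^sup>2 * (norm q)\<^sup>2)"
    using jac_linearization_bound[OF h_diff h_lip(2), of y "- \<tau> *\<^sub>R q"] h_lip(1)
    by (simp add: power_mult_distrib)
  moreover have "jac h y *v (- \<tau> *\<^sub>R q) = - (\<tau> *\<^sub>R (jac h y *v q))"
    by (metis matrix_vector_mult_scaleR scaleR_minus_left)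
  ultimately have "norm (h (y - \<tau> *\<^sub>R q) - (w - \<tau> *\<^sub>R (jac h y *v q))) \<le> Lh * (\<tau>\<^sup>2 * (norm q)\<^sup>2)"
    by (simp add: w_def algebra_simps)
  also have "\<dots> \<le> Lh * (\<tau>\<^sup>2 * (C2 * \<theta> / \<kappa> * norm w))"
  proof -
    have "(norm q)\<^sup>2 \<le> (sqrt C2 * norm w)\<^sup>2"
      using norm_transpose_jac_h(3)[OF y] unfolding q_def by (intro power_mono) auto
    also have "\<dots> = C2 * (norm w * norm w)"
      using h_eig(2,3) by (simp add: power_mult_distrib power2_eq_square)
    \<comment> \<open>One of the two factors |h(y)| is traded for \<theta>/\<kappa>.\<close>
    also have "\<dots> \<le> C2 * (\<theta> / \<kappa> * norm w)"
      using feas h_eig(2,3) unfolding w_def by (intro mult_left_mono mult_right_mono) auto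
    finally show ?thesis using h_lip(1) by (intro mult_left_mono) auto
  qed
  finally have rem: "norm (h (y - \<tau> *\<^sub>R q) - (w - \<tau> *\<^sub>R (jac h y *v q))) \<le> \<dots>" .
  show ?thesis
    using norm_triangle_sub[of "h (y - \<tau> *\<^sub>R q)" "w - \<tau> *\<^sub>R (jac h y *v q)"] lin rem
    unfolding w_def[symmetric] q_def[symmetric] correction_const_def by (simp add: algebra_simps)
qed

text \<open>The first two smallness conditions after \<tau> > 0 make |h| non-increasing, the next
  keeps the move below \<theta> and hence its segment in the tube of radius 2\<theta>, and the last
  is the merit balance.\<close>

lemma gradient_correction:
  assumes feas: "norm (h y) \<le> \<theta> / \<kappa>" and \<alpha>: "0 < \<alpha>"
    and z: "z = y - \<tau> *\<^sub>R (transpose (jac h y) *v h y)"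
    and \<tau>: "0 < \<tau>" "C2 * \<tau> < 1" "correction_const * \<tau> < C1" "sqrt C2 / \<kappa> * \<tau> < 1"
      "(\<alpha> * correction_const + \<sigma> / 2) * \<tau> < \<alpha> * C1 - sqrt C2 * (lf + lg * lA)"
  shows "norm (h z) \<le> \<theta> / \<kappa>"
    and "merit f g A h \<alpha> z \<le> merit f g A h \<alpha> y - \<sigma> / 2 * (\<tau>\<^sup>2 * norm (h y))"
proof -
  let ?K = correction_const and ?w = "norm (h y)"
  have "infdist y M \<le> \<kappa> * ?w" by (rule kappa(2))
  also have "\<dots> \<le> \<theta>" using feas kappa(1) by (simp add: field_simps)
  finally have y_dist: "infdist y M \<le> \<theta>" .
  then have y: "y \<in> tube M (2 * \<theta>)" using h_eig(1) by (simp add: tube_def)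
  note hz = norm_h_gradient_correction_le[OF y feas \<tau>(1,2), folded z]
  also have "(1 - \<tau> * C1 + \<tau>\<^sup>2 * ?K) * ?w \<le> 1 * ?w"
    using mult_left_mono[OF less_imp_le[OF \<tau>(3)], of \<tau>] \<tau>(1)
    by (intro mult_right_mono) (auto simp: power2_eq_square algebra_simps)
  finally show "norm (h z) \<le> \<theta> / \<kappa>" using feas by simp
  have zy: "norm (z - y) \<le> \<tau> * sqrt C2 * ?w"
    using norm_transpose_jac_h(3)[OF y, of "h y"] \<tau>(1) unfolding z
    by (simp add: mult_left_mono mult.assoc)
  also have "\<dots> \<le> \<tau> * sqrt C2 * (\<theta> / \<kappa>)"
    using feas \<tau>(1) h_eig(2,3) by (intro mult_left_mono) auto
  also have "\<dots> \<le> 1 * \<theta>"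
    using mult_right_mono[OF less_imp_le[OF \<tau>(4)], of \<theta>] h_eig(1) by (simp add: algebra_simps)
  finally have "norm (z - y) \<le> \<theta>" by simp
  then have "closed_segment y z \<subseteq> tube M (2 * \<theta>)"
  proof (intro subsetI)
    fix u assume "u \<in> closed_segment y z"
    then have "dist u y \<le> norm (z - y)"
      using segment_bound(1) by (simp add: dist_norm)
    then show "u \<in> tube M (2 * \<theta>)"
      using infdist_triangle[of u M y] y_dist \<open>norm (z - y) \<le> \<theta>\<close> by (simp add: tube_def)
  qed
  then have "objective f g A z \<le> objective f g A y + (lf + lg * lA) * norm (z - y)"
    using objective_diff_le by fastforce
  also have "(lf + lg * lA) * norm (z - y) \<le> (lf + lg * lA) * (\<tau> * sqrt C2 * ?w)"
    using zy lf(1) lA(1) lg_nonneg by (intro mult_left_mono) auto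
  finally have F: "objective f g A z \<le> objective f g A y + (lf + lg * lA) * (\<tau> * sqrt C2 * ?w)"
    by simp
  have "\<alpha> * norm (h z) \<le> \<alpha> * ((1 - \<tau> * C1 + \<tau>\<^sup>2 * ?K) * ?w)"
    using hz \<alpha> by (intro mult_left_mono) auto
  \<comment> \<open>The first-order surplus \<alpha> C_1 - M_1 pays for both the \<tau>^2 error in
    |h| and the decrease demanded by the test.\<close>
  moreover have "(\<tau> * ?w) * ((\<alpha> * ?K + \<sigma> / 2) * \<tau>)
      \<le> (\<tau> * ?w) * (\<alpha> * C1 - sqrt C2 * (lf + lg * lA))"
    using \<tau>(1,5) by (intro mult_left_mono) auto
  ultimately show "merit f g A h \<alpha> z \<le> merit f g A h \<alpha> y - \<sigma> / 2 * (\<tau>\<^sup>2 * ?w)"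
    using F unfolding merit_def by (simp add: algebra_simps power2_eq_square)
qed

text \<open>Reaching M removes \<alpha> |h(y)| from the merit, while F rises by at most (lf + lg lA)
  dist(y, M) \<le> M_2 |h(y)|.\<close>

lemma projection_correction:
  assumes y: "y \<in> tube M (2 * \<theta>)" and z: "is_arg_min (dist y) (\<lambda>w. w \<in> M) z"
    and \<tau>: "\<sigma> / 2 * \<tau>\<^sup>2 \<le> \<alpha> - \<kappa> * (lf + lg * lA)"
  shows "h z = 0"
    and "merit f g A h \<alpha> z \<le> merit f g A h \<alpha> y - \<sigma> / 2 * (\<tau>\<^sup>2 * norm (h y))"
proof -
  have zM: "z \<in> M" and "\<And>w. w \<in> M \<Longrightarrow> dist y z \<le> dist y w"
    using z by (auto simp: is_arg_min_def not_less)
  then have yz: "dist y z \<le> infdist y M"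
    unfolding infdist_notempty[OF M_nonempty] by (intro cINF_greatest M_nonempty)
  show hz: "h z = 0" using zM M_eq by simp
  have "closed_segment y z \<subseteq> tube M (2 * \<theta>)"
  proof
    \<comment> \<open>Since \<open>z\<close> is in M, points of the segment are no farther from M
      than \<open>y\<close> is; the tube of radius 2\<theta> is not left.\<close>
    fix u assume "u \<in> closed_segment y z"
    then have "dist u z \<le> dist y z"
      using segment_bound(2) by (metis dist_norm dist_commute)
    then show "u \<in> tube M (2 * \<theta>)"
      using infdist_le[OF zM, of u] yz y by (simp add: tube_def)
  qed
  then have "objective f g A z \<le> objective f g A y + (lf + lg * lA) * norm (z - y)"
    using objective_diff_le by fastforce
  also have "(lf + lg * lA) * norm (z - y) \<le> (lf + lg * lA) * (\<kappa> * norm (h y))"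
    using yz kappa(2)[of y] lf(1) lA(1) lg_nonneg
    by (intro mult_left_mono) (auto simp: dist_norm norm_minus_commute)
  finally have F: "objective f g A z \<le> objective f g A y + (lf + lg * lA) * (\<kappa> * norm (h y))"
    by simp
  have "\<sigma> / 2 * \<tau>\<^sup>2 * norm (h y) \<le> (\<alpha> - \<kappa> * (lf + lg * lA)) * norm (h y)"
    using \<tau> by (intro mult_right_mono) auto
  then show "merit f g A h \<alpha> z \<le> merit f g A h \<alpha> y - \<sigma> / 2 * (\<tau>\<^sup>2 * norm (h y))"
    using F hz unfolding merit_def by (simp add: algebra_simps)
qed

text \<open>The threshold on \<tau> is chosen before \<open>y\<close> and \<open>z\<close>; a bound
  depending on the point could not give one trial index for all k.\<close>

lemma eventually_trial_point_decrease:
  assumes \<alpha>: "0 < \<alpha>" "sqrt C2 * (lf + lg * lA) < \<alpha> * C1" "\<kappa> * (lf + lg * lA) < \<alpha>"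
  shows "\<forall>\<^sub>F \<tau> in at_right 0. \<forall>y z. y \<in> tube M (2 * \<theta>) \<longrightarrow> is_trial_point M h (\<theta> / \<kappa>) \<tau> y z \<longrightarrow>
    norm (h z) \<le> \<theta> / \<kappa> \<and>
    merit f g A h \<alpha> z \<le> merit f g A h \<alpha> y - \<sigma> / 2 * (\<tau>\<^sup>2 * norm (h y))"
proof -
  have pos: "\<forall>\<^sub>F \<tau>::real in at_right 0. 0 < \<tau>"
    by (simp add: eventually_at_right_less)
  have "((\<lambda>\<tau>. \<sigma> / 2 * \<tau>\<^sup>2) \<longlongrightarrow> 0) (at_right 0)" by (auto intro!: tendsto_eq_intros)
  then have sq: "\<forall>\<^sub>F \<tau> in at_right 0. \<sigma> / 2 * \<tau>\<^sup>2 < \<alpha> - \<kappa> * (lf + lg * lA)"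
    using \<alpha>(3) by (intro order_tendstoD(2)) auto
  have small: "\<forall>\<^sub>F \<tau> in at_right 0. C2 * \<tau> < 1"
    "\<forall>\<^sub>F \<tau> in at_right 0. correction_const * \<tau> < C1"
    "\<forall>\<^sub>F \<tau> in at_right 0. sqrt C2 / \<kappa> * \<tau> < 1"
    "\<forall>\<^sub>F \<tau> in at_right 0. (\<alpha> * correction_const + \<sigma> / 2) * \<tau>
      < \<alpha> * C1 - sqrt C2 * (lf + lg * lA)"
    using \<alpha>(2) h_eig(2) by - (rule eventually_at_right_mult_less, simp)+
  from pos sq small show ?thesis
  proof eventually_elim
    case (elim \<tau>)
    show ?case
    proof (intro allI impI)
      fix y z assume y: "y \<in> tube M (2 * \<theta>)" and trial: "is_trial_point M h (\<theta> / \<kappa>) \<tau> y z"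
      show "norm (h z) \<le> \<theta> / \<kappa> \<and>
        merit f g A h \<alpha> z \<le> merit f g A h \<alpha> y - \<sigma> / 2 * (\<tau>\<^sup>2 * norm (h y))"
      proof (cases "norm (h y) \<le> \<theta> / \<kappa>")
        case True
        then have z: "z = y - \<tau> *\<^sub>R (transpose (jac h y) *v h y)"
          using trial by (simp add: is_trial_point_def gradient_infeasibility[OF h_diff])
        show ?thesis using gradient_correction[OF True \<alpha>(1) z elim(1,3-6)] by blast
      next
        case False
        then have z: "is_arg_min (dist y) (\<lambda>w. w \<in> M) z"
          using trial by (simp add: is_trial_point_def)
        show ?thesis
          using projection_correction[OF y z less_imp_le[OF elim(2)]] h_eig(1) kappa(1) by simp
      qed
    qed
  qed
qed

subsection \<open>Bounded multipliers and stationarity\<close>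

text \<open>|l| is affine in |m|, |m| is affine in |v|, and |d|^2 + |v|^2 is at most affine in |d| +
  |v|. The last bound closes on itself and then yields the other two.\<close>

lemma inexact_dual_step_bounded:
  assumes tmin: "0 < tmin" and \<Delta>max: "0 \<le> \<Delta>max"
  obtains B where "0 \<le> B"
    "\<forall>t \<Delta> x l m d v. inexact_dual_step f g A h t \<Delta> x l m d v \<longrightarrow> tmin \<le> t \<longrightarrow> t \<le> tmax \<longrightarrow>
      \<Delta> \<le> \<Delta>max \<longrightarrow> x \<in> tube M (2 * \<theta>) \<longrightarrow> norm d \<le> B \<and> norm v \<le> B \<and> norm l \<le> B \<and> norm m \<le> B"
proof -
  \<comment> \<open>With q = J_h^T l, \<open>c\<close> is the part of the bound on |q| free of
    \<open>m\<close>. \<open>a\<close> and \<open>b\<close> are slope and intercept of the energy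
    bound, and \<open>R\<close> is what \<open>le_if_square_le_affine\<close> returns for them after
    scaling by 2 |tmax|.\<close>
  define c where "c = \<Delta>max / (tmin * sqrt C1) + lf"
  define a where "a = lf + lg + \<Delta>max * (lA / tmin / sqrt C1 + 1 / tmin)"
  define b where "b = \<Delta>max * ((c + lA * lg) / sqrt C1 + lg)"
  define R where "R = 2 * (\<bar>tmax\<bar> * a) + 2 * (\<bar>tmax\<bar> * b) + 1"
  define Bm where "Bm = lg + R / tmin"
  define Bl where "Bl = (c + lA * Bm) / sqrt C1"
  have C1: "0 < sqrt C1" using h_eig(2) by simp
  have c0: "0 \<le> c" using lf(1) tmin \<Delta>max C1 by (simp add: c_def)
  have a0: "0 \<le> a" using lf(1) lA(1) lg_nonneg tmin \<Delta>max C1 by (simp add: a_def)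
  have b0: "0 \<le> b" using c0 lA(1) lg_nonneg \<Delta>max C1 by (simp add: b_def)
  have R0: "0 \<le> R" using a0 b0 by (simp add: R_def)
  have Bm0: "0 \<le> Bm" using R0 lg_nonneg tmin by (simp add: Bm_def)
  have Bl0: "0 \<le> Bl" using Bm0 c0 lA(1) C1 by (simp add: Bl_def)
  have bounds: "norm d + norm v \<le> R" "norm m \<le> Bm" "norm l \<le> Bl"
    if step: "inexact_dual_step f g A h t \<Delta> x l m d v" and t: "tmin \<le> t" "t \<le> tmax"
      and \<Delta>: "\<Delta> \<le> \<Delta>max" and x: "x \<in> tube M (2 * \<theta>)" for t \<Delta> x l m d v
  proof -
    let ?H = "jac h x" and ?B = "jac A x"
    define s where "s = m - (1 / t) *\<^sub>R v"
    define q where "q = transpose ?H *v l"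
    have t0: "0 < t" using t(1) tmin by simp
    have Hd: "norm (?H *v d) \<le> \<Delta>max" and Bd: "norm (v - ?B *v d) \<le> \<Delta>max"
      and s_sub: "s \<in> subdifferential g (A x + v)"
      using step \<Delta> unfolding inexact_dual_step_def s_def by auto
    have s: "norm s \<le> lg" by (rule norm_subgradient_le[OF g_lip s_sub])
    have m_eq: "m = s + (1 / t) *\<^sub>R v" by (simp add: s_def)
    have m_le: "norm m \<le> lg + norm v / tmin"
    proof -
      have "norm ((1 / t) *\<^sub>R v) \<le> norm v / tmin"
        using t(1) tmin t0 by (simp add: frac_le)
      then show ?thesis unfolding m_eq using s norm_triangle_ineq[of s "(1 / t) *\<^sub>R v"] by linarith
    qed
    have l_q: "norm l \<le> norm q / sqrt C1"
      using norm_transpose_jac_h(2)[OF x, of l] C1 unfolding q_def by (simp add: field_simps)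
    have q_le: "norm q \<le> c + lA * norm m"
    proof (cases "q = 0")
      case True
      then show ?thesis using c0 lA(1) by simp
    next
      case False
      have "d = - t *\<^sub>R dual_residual f A h x l m"
        using step by (simp add: inexact_dual_step_def)
      then have "dual_residual f A h x l m = - ((1 / t) *\<^sub>R d)" using t0 by simp
      then have q_eq: "q = - ((1 / t) *\<^sub>R d) - gradient f x - transpose ?B *v m"
        by (simp only: dual_residual_def q_def[symmetric] eq_diff_eq add_ac)
      \<comment> \<open>Testing with \<open>q\<close> turns the term in d into l . J_h d, which is
        small relative to |l|. Estimating |d|/t directly would put the still unbounded d into
        \<open>c\<close>.\<close>
      have "q \<bullet> q = - (1 / t) * (l \<bullet> (?H *v d)) - q \<bullet> gradient f x - q \<bullet> (transpose ?B *v m)"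
      proof -
        have "q \<bullet> q = q \<bullet> (- ((1 / t) *\<^sub>R d)) - q \<bullet> gradient f x - q \<bullet> (transpose ?B *v m)"
          by (subst (2) q_eq) (simp only: inner_diff_right)
        moreover have "q \<bullet> d = l \<bullet> (?H *v d)" unfolding q_def by (rule inner_transpose_mult)
        ultimately show ?thesis by simp
      qed
      also have "\<dots> \<le> norm q * (\<Delta>max / (tmin * sqrt C1)) + norm q * lf + norm q * (lA * norm m)"
      proof -
        have "- (1 / t) * (l \<bullet> (?H *v d)) \<le> norm q * (\<Delta>max / (tmin * sqrt C1))"
        proof -
          have "- (1 / t) * (l \<bullet> (?H *v d)) \<le> (1 / t) * \<bar>l \<bullet> (?H *v d)\<bar>"
            using t0 by (simp add: field_simps)
          also have "\<dots> \<le> (1 / tmin) * (norm l * norm (?H *v d))"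
            using t(1) tmin t0 by (intro mult_mono Cauchy_Schwarz_ineq2) (auto simp: frac_le)
          also have "\<dots> \<le> (1 / tmin) * (norm q / sqrt C1 * \<Delta>max)"
            using tmin C1 by (intro mult_left_mono mult_mono l_q Hd) auto
          finally show ?thesis by (simp add: field_simps)
        qed
        moreover have "- (q \<bullet> gradient f x) \<le> norm q * lf"
        proof -
          have "- (q \<bullet> gradient f x) \<le> norm q * norm (gradient f x)"
            using Cauchy_Schwarz_ineq2[of q "gradient f x"] by linarith
          also have "\<dots> \<le> norm q * lf" using lf(2)[OF x] by (intro mult_left_mono) auto
          finally show ?thesis .
        qed
        moreover have "- (q \<bullet> (transpose ?B *v m)) \<le> norm q * (lA * norm m)"
        proof -
          have "norm (transpose ?B *v m) \<le> lA * norm m"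
            using norm_transpose_mult_le_spectral lA(2)[OF x]
            by (meson mult_right_mono norm_ge_zero order_trans)
          then have "norm q * norm (transpose ?B *v m) \<le> norm q * (lA * norm m)"
            by (intro mult_left_mono) auto
          then show ?thesis
            using Cauchy_Schwarz_ineq2[of q "transpose ?B *v m"] by linarith
        qed
        ultimately show ?thesis by linarith
      qed
      also have "\<dots> = norm q * (c + lA * norm m)" by (simp add: c_def algebra_simps)
      finally show ?thesis
        using False by (simp add: power2_norm_eq_inner[symmetric] power2_eq_square)
    qed
    have l_le: "norm l \<le> (c + lA * norm m) / sqrt C1"
      using l_q q_le C1 by (meson divide_right_mono less_imp_le order_trans)
    have l_le': "norm l \<le> (c + lA * lg) / sqrt C1 + lA / tmin / sqrt C1 * norm v"
    proof -
      have "lA * norm m \<le> lA * (lg + norm v / tmin)" using m_le lA(1) by (intro mult_left_mono) auto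
      then have "(c + lA * norm m) / sqrt C1 \<le> (c + lA * (lg + norm v / tmin)) / sqrt C1"
        using C1 by (intro divide_right_mono) auto
      also have "\<dots> = (c + lA * lg) / sqrt C1 + lA / tmin / sqrt C1 * norm v"
        using C1 tmin by (simp add: field_simps)
      finally show ?thesis using l_le by linarith
    qed
    \<comment> \<open>Energy identity: m . v = s . v + |v|^2/t supplies the square of v, and the
      rest is first order, since |s| \<le> lg and the multipliers meet only quantities of size
      \<Delta>.\<close>
    have "(1 / t) * ((norm d)\<^sup>2 + (norm v)\<^sup>2)
        = - (gradient f x \<bullet> d) - l \<bullet> (?H *v d) - s \<bullet> v + m \<bullet> (v - ?B *v d)"
    proof -
      have "m \<bullet> v = s \<bullet> v + (1 / t) * (norm v)\<^sup>2"
        unfolding m_eq by (simp add: inner_add_left power2_norm_eq_inner)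
      then show ?thesis
        using inexact_dual_step_inner[OF step t0] by (simp add: inner_diff_right algebra_simps)
    qed
    also have "\<dots> \<le> lf * norm d + norm l * \<Delta>max + lg * norm v + norm m * \<Delta>max"
    proof -
      have "- (gradient f x \<bullet> d) \<le> lf * norm d"
        using Cauchy_Schwarz_ineq2[of "gradient f x" d] mult_right_mono[OF lf(2)[OF x] norm_ge_zero[of d]]
        by linarith
      moreover have "- (l \<bullet> (?H *v d)) \<le> norm l * \<Delta>max"
        using Cauchy_Schwarz_ineq2[of l "?H *v d"] mult_left_mono[OF Hd norm_ge_zero[of l]] by linarith
      moreover have "- (s \<bullet> v) \<le> lg * norm v"
        using Cauchy_Schwarz_ineq2[of s v] mult_right_mono[OF s norm_ge_zero[of v]] by linarith
      moreover have "m \<bullet> (v - ?B *v d) \<le> norm m * \<Delta>max"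
        using Cauchy_Schwarz_ineq2[of m "v - ?B *v d"] mult_left_mono[OF Bd norm_ge_zero[of m]] by linarith
      ultimately show ?thesis by linarith
    qed
    also have "\<dots> \<le> a * (norm d + norm v) + b"
    proof -
      have "norm l * \<Delta>max + norm m * \<Delta>max
          \<le> ((c + lA * lg) / sqrt C1 + lA / tmin / sqrt C1 * norm v) * \<Delta>max
            + (lg + norm v / tmin) * \<Delta>max"
        using l_le' m_le \<Delta>max by (intro add_mono mult_right_mono) auto
      also have "\<dots> = b + \<Delta>max * (lA / tmin / sqrt C1 + 1 / tmin) * norm v"
        by (simp add: b_def algebra_simps)
      finally have "lf * norm d + norm l * \<Delta>max + lg * norm v + norm m * \<Delta>max
          \<le> lf * norm d + lg * norm v + \<Delta>max * (lA / tmin / sqrt C1 + 1 / tmin) * norm v + b"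
        by linarith
      also have "\<dots> \<le> lf * (norm d + norm v) + lg * (norm d + norm v)
          + \<Delta>max * (lA / tmin / sqrt C1 + 1 / tmin) * (norm d + norm v) + b"
        using lf(1) lA(1) lg_nonneg tmin \<Delta>max C1
        by (intro add_mono mult_left_mono order_refl) auto
      also have "\<dots> = a * (norm d + norm v) + b" by (simp add: a_def distrib_right)
      finally show ?thesis .
    qed
    finally have "(norm d)\<^sup>2 + (norm v)\<^sup>2 \<le> t * (a * (norm d + norm v) + b)"
      using t0 by (simp add: field_simps)
    also have "\<dots> \<le> \<bar>tmax\<bar> * (a * (norm d + norm v) + b)"
      using t(2) a0 b0 by (intro mult_right_mono) auto
    finally have sum_le: "(norm d)\<^sup>2 + (norm v)\<^sup>2 \<le> \<bar>tmax\<bar> * (a * (norm d + norm v) + b)" .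
    have "(norm d + norm v)\<^sup>2 \<le> 2 * ((norm d)\<^sup>2 + (norm v)\<^sup>2)"
      using sum_squares_ge_zero[of "norm d - norm v" 0] by (simp add: power2_eq_square algebra_simps)
    also have "\<dots> \<le> 2 * (\<bar>tmax\<bar> * a) * (norm d + norm v) + 2 * (\<bar>tmax\<bar> * b)"
      using sum_le by (simp add: algebra_simps)
    finally show dv: "norm d + norm v \<le> R"
      unfolding R_def using a0 b0 by (intro le_if_square_le_affine) auto
    then have "norm v \<le> R" using norm_ge_zero[of d] by linarith
    then have "norm v / tmin \<le> R / tmin" using tmin by (simp add: divide_right_mono)
    then show m: "norm m \<le> Bm" using m_le unfolding Bm_def by linarith
    have "lA * norm m \<le> lA * Bm" using m lA(1) by (intro mult_left_mono) auto
    then have "(c + lA * norm m) / sqrt C1 \<le> Bl"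
      unfolding Bl_def using C1 by (intro divide_right_mono) auto
    then show "norm l \<le> Bl" using l_le by linarith
  qed
  show thesis
  proof (rule that[of "R + Bm + Bl"]; (intro allI impI)?)
    show "0 \<le> R + Bm + Bl" using R0 Bm0 Bl0 by simp
    fix t \<Delta> x l m d v
    assume "inexact_dual_step f g A h t \<Delta> x l m d v" "tmin \<le> t" "t \<le> tmax" "\<Delta> \<le> \<Delta>max"
      "x \<in> tube M (2 * \<theta>)"
    note bounds[OF this]
    then show "norm d \<le> R + Bm + Bl \<and> norm v \<le> R + Bm + Bl \<and> norm l \<le> R + Bm + Bl \<and> norm m \<le> R + Bm + Bl"
      using norm_ge_zero[of d] norm_ge_zero[of v] R0 Bm0 Bl0 by linarith
  qed
qed

lemma isCont_data: "isCont f z" "isCont A z" "isCont h z" "isCont g w" "isCont (gradient f) z"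
  using differentiable_imp_continuous_within[OF f_diff]
    differentiable_imp_continuous_within[OF A_diff] differentiable_imp_continuous_within[OF h_diff]
    lipschitz_on_continuous_on[OF g_lip] lipschitz_on_continuous_on[OF f_lip]
  by (auto simp: continuous_on_eq_continuous_at)

text \<open>A tube around the compact M lies in a ball, on which the continuous merit function is
  bounded.\<close>

lemma merit_bounded_below_on_tube:
  obtains c where "\<And>z. z \<in> tube M r \<Longrightarrow> c \<le> merit f g A h \<alpha> z"
proof -
  obtain R where R: "\<And>w. w \<in> M \<Longrightarrow> norm w \<le> R"
    using compact_imp_bounded[OF M_compact] unfolding bounded_iff by blast
  have "isCont (merit f g A h \<alpha>) z" for z
    unfolding merit_def[abs_def] objective_def
    by (intro continuous_intros isCont_data isCont_o2[OF isCont_data(2) isCont_data(4)])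
  then have "continuous_on (cball 0 (R + r)) (merit f g A h \<alpha>)"
    by (simp add: continuous_at_imp_continuous_on)
  then have "compact (merit f g A h \<alpha> ` cball 0 (R + r))"
    by (intro compact_continuous_image) auto
  then have "bdd_below (merit f g A h \<alpha> ` cball 0 (R + r))"
    by (intro bounded_imp_bdd_below compact_imp_bounded)
  then obtain c where c: "\<And>z. z \<in> cball 0 (R + r) \<Longrightarrow> c \<le> merit f g A h \<alpha> z"
    unfolding bdd_below_def by blast
  have "z \<in> cball 0 (R + r)" if "z \<in> tube M r" for z
  proof -
    obtain w where w: "w \<in> M" "infdist z M = dist z w"
      using infdist_attains_inf[OF compact_imp_closed[OF M_compact] M_nonempty] by blast
    then show ?thesis
      using R[OF w(1)] that norm_triangle_sub[of z w] by (simp add: tube_def dist_norm)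
  qed
  then show thesis using c that by blast
qed

text \<open>Bounded multipliers converge along a subsequence. The residual equals -d/t and tends to
  0, and the subdifferential has a closed graph.\<close>

lemma stationary_point_if_steps_vanish:
  assumes steps: "\<And>k. inexact_dual_step f g A h (t k) (\<Delta> k) (X k) (l k) (m k) (d k) (v k)"
    and t: "0 < tmin" "\<And>k. tmin \<le> t k"
    and bounded: "\<And>k. norm (l k) \<le> B" "\<And>k. norm (m k) \<le> B"
    and X: "X \<longlonglongrightarrow> z" and d: "d \<longlonglongrightarrow> 0" and v: "v \<longlonglongrightarrow> 0" and hz: "h z = 0"
  shows "stationary_point f g A h z"
proof -
  have "bounded (range (\<lambda>k. (l k, m k)))"
  proof (rule boundedI)
    fix q assume "q \<in> range (\<lambda>k. (l k, m k))"
    then obtain k where "q = (l k, m k)" by blast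
    then show "norm q \<le> B + B"
      using norm_Pair_le[of "l k" "m k"] bounded[of k] by simp
  qed
  then obtain q s where s: "strict_mono s" "((\<lambda>k. (l k, m k)) \<circ> s) \<longlonglongrightarrow> q"
    using bounded_imp_convergent_subsequence by blast
  define lz mz where "lz = fst q" and "mz = snd q"
  have l: "(\<lambda>k. l (s k)) \<longlonglongrightarrow> lz" and m: "(\<lambda>k. m (s k)) \<longlonglongrightarrow> mz"
    using tendsto_fst[OF s(2)] tendsto_snd[OF s(2)] by (simp_all add: o_def lz_def mz_def)
  have X': "(\<lambda>k. X (s k)) \<longlonglongrightarrow> z" and v': "(\<lambda>k. v (s k)) \<longlonglongrightarrow> 0"
    using LIMSEQ_subseq_LIMSEQ[OF X s(1)] LIMSEQ_subseq_LIMSEQ[OF v s(1)]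
    by (simp_all add: o_def)
  \<comment> \<open>Only the lower bound on t enters, so the step sizes t themselves may
    oscillate.\<close>
  have scaled: "(\<lambda>k. (1 / t (s k)) *\<^sub>R u (s k)) \<longlonglongrightarrow> 0" if "u \<longlonglongrightarrow> 0"
    for u :: "nat \<Rightarrow> 'c::real_normed_vector"
  proof (rule Lim_null_comparison)
    have tpos: "0 < t k" for k using t(1) t(2)[of k] by linarith
    show "\<forall>\<^sub>F k in sequentially. norm ((1 / t (s k)) *\<^sub>R u (s k)) \<le> norm (u (s k)) / tmin"
      using t tpos by (auto intro!: always_eventually frac_le simp: abs_of_pos)
    have "(\<lambda>k. u (s k)) \<longlonglongrightarrow> 0"
      using LIMSEQ_subseq_LIMSEQ[OF that s(1)] by (simp add: o_def)
    from tendsto_divide[OF tendsto_norm[OF this] tendsto_const, of tmin]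
    show "(\<lambda>k. norm (u (s k)) / tmin) \<longlonglongrightarrow> 0"
      using t(1) by simp
  qed
  have "(\<lambda>k. dual_residual f A h (X (s k)) (l (s k)) (m (s k)))
      \<longlonglongrightarrow> gradient f z + transpose (jac h z) *v lz + transpose (jac A z) *v mz"
    unfolding dual_residual_def
    by (intro tendsto_add isCont_tendsto_compose[OF isCont_data(5) X']
        tendsto_transpose_jac_mult[OF h_lip(2) X' l] tendsto_transpose_jac_mult[OF A_lip X' m])
  moreover have "dual_residual f A h (X k) (l k) (m k) = - ((1 / t k) *\<^sub>R d k)" for k
    using steps[of k] t(1) t(2)[of k] by (simp add: inexact_dual_step_def)
  moreover have "(\<lambda>k. - ((1 / t (s k)) *\<^sub>R d (s k))) \<longlonglongrightarrow> - 0"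
    by (intro tendsto_minus scaled d)
  ultimately have residual: "gradient f z + transpose (jac h z) *v lz + transpose (jac A z) *v mz = 0"
    using LIMSEQ_unique by fastforce
  have "mz \<in> subdifferential g (A z)"
    unfolding subdifferential_def
  proof safe
    fix w
    have A_lim: "(\<lambda>k. A (X (s k)) + v (s k)) \<longlonglongrightarrow> A z + 0"
      by (intro tendsto_add isCont_tendsto_compose[OF isCont_data(2) X'] v')
    have "(\<lambda>k. g (A (X (s k)) + v (s k))
        + (m (s k) - (1 / t (s k)) *\<^sub>R v (s k)) \<bullet> (w - (A (X (s k)) + v (s k))))
        \<longlonglongrightarrow> g (A z + 0) + (mz - 0) \<bullet> (w - (A z + 0))"
      by (intro tendsto_add tendsto_inner tendsto_diff isCont_tendsto_compose[OF isCont_data(4) A_lim]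
          m scaled v tendsto_const A_lim)
    moreover have "g (A (X (s k)) + v (s k))
        + (m (s k) - (1 / t (s k)) *\<^sub>R v (s k)) \<bullet> (w - (A (X (s k)) + v (s k))) \<le> g w" for k
      using steps[of "s k"] unfolding inexact_dual_step_def subdifferential_def by blast
    ultimately show "g (A z) + mz \<bullet> (w - A z) \<le> g w"
      using LIMSEQ_le_const2 by fastforce
  qed
  then show ?thesis
    unfolding stationary_point_def using hz residual
    by (intro conjI exI[of _ lz] image_eqI[of _ _ mz]) (simp_all add: add_ac)
qed

text \<open>Every threshold on \<open>j\<close> depends only on \<open>B\<close>,
  \<open>tmax\<close> and constants of the problem, so all points and steps can be quantified
  inside.\<close>

lemma eventually_trial_accepted:
  assumes \<alpha>: "0 < \<alpha>" "sqrt C2 * (lf + lg * lA) < \<alpha> * C1" "\<kappa> * (lf + lg * lA) < \<alpha>"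
    and t: "0 < tmin" "0 < tmax" and B: "0 \<le> B"
    and \<eta>: "filterlim \<eta> (at_right 0) sequentially" and \<tau>: "filterlim \<tau> (at_right 0) sequentially"
  shows "\<forall>\<^sub>F j in sequentially. \<forall>x t \<Delta> l m d v z.
    infdist x M \<le> \<theta> \<longrightarrow> 0 < t \<longrightarrow> t \<le> tmax \<longrightarrow> norm d \<le> B \<longrightarrow>
    inexact_dual_step f g A h t \<Delta> x l m d v \<longrightarrow>
    is_trial_point M h (\<theta> / \<kappa>) (\<tau> j) (x + \<eta> j *\<^sub>R d) z \<longrightarrow>
    norm (h z) \<le> \<theta> / \<kappa> \<and>
    merit f g A h \<alpha> z \<le> merit f g A h \<alpha> x
      - \<sigma> / 2 * ((\<eta> j)\<^sup>2 * (norm d)\<^sup>2 + (\<tau> j)\<^sup>2 * norm (h (x + \<eta> j *\<^sub>R d)))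
      - \<eta> j / (2 * t) * (norm v)\<^sup>2 + \<eta> j * (\<alpha> + lg + norm l + norm m) * \<Delta>"
proof -
  let ?K = "Lf + lg * \<bar>LA\<bar> + \<alpha> * Lh"
  have "\<forall>\<^sub>F j in sequentially. 0 < \<eta> j"
    by (rule eventually_compose_filterlim[OF eventually_at_right_less \<eta>])
  \<comment> \<open>In turn: \<eta> < 1 for convexity of g, a move shorter than \<theta> so that y
    stays in the tube of radius 2\<theta>, and (next line) second-order terms dominated by the drop
    |d|^2/t.\<close>
  moreover have "\<forall>\<^sub>F j in sequentially. 1 * \<eta> j < 1" "\<forall>\<^sub>F j in sequentially. B * \<eta> j < \<theta>"
    "\<forall>\<^sub>F j in sequentially. (?K + \<sigma> / 2) * \<eta> j < 1 / tmax"
    using t(2) h_eig(1)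
    by - (rule eventually_compose_filterlim[OF eventually_at_right_mult_less \<eta>], simp)+
  moreover note eventually_compose_filterlim[OF eventually_trial_point_decrease[OF \<alpha>] \<tau>, of \<sigma>]
  ultimately show ?thesis
  proof eventually_elim
    case (elim j)
    show ?case
    proof (intro allI impI)
      fix x t \<Delta> l m d v z
      assume x: "infdist x M \<le> \<theta>" and t: "0 < t" "t \<le> tmax" and d: "norm d \<le> B"
        and step: "inexact_dual_step f g A h t \<Delta> x l m d v"
        and trial: "is_trial_point M h (\<theta> / \<kappa>) (\<tau> j) (x + \<eta> j *\<^sub>R d) z"
      let ?y = "x + \<eta> j *\<^sub>R d"
      have "norm (\<eta> j *\<^sub>R d) \<le> B * \<eta> j"
        using d elim(1) by (simp add: mult.commute mult_left_mono)
      then have "?y \<in> tube M (2 * \<theta>)"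
        using infdist_triangle[of ?y M x] x elim(3) by (simp add: tube_def dist_norm)
      with elim(5) trial have z: "norm (h z) \<le> \<theta> / \<kappa>"
        "merit f g A h \<alpha> z \<le> merit f g A h \<alpha> ?y - \<sigma> / 2 * ((\<tau> j)\<^sup>2 * norm (h ?y))"
        by blast+
      have "1 / tmax \<le> 1 / t" using t by (simp add: frac_le)
      then have "((?K + \<sigma> / 2) * \<eta> j) * (\<eta> j * (norm d)\<^sup>2) \<le> (1 / t) * (\<eta> j * (norm d)\<^sup>2)"
        using elim(1,4) by (intro mult_right_mono) auto
      then have "?K * (\<eta> j)\<^sup>2 * (norm d)\<^sup>2 - \<eta> j / t * (norm d)\<^sup>2 \<le> - \<sigma> / 2 * ((\<eta> j)\<^sup>2 * (norm d)\<^sup>2)"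
        by (simp add: power2_eq_square algebra_simps)
      moreover have "\<eta> j / (2 * t) * (norm v)\<^sup>2 \<le> \<eta> j / t * (norm v)\<^sup>2"
        using t elim(1) by (intro mult_right_mono divide_left_mono) auto
      moreover have "merit f g A h \<alpha> ?y \<le> merit f g A h \<alpha> x - \<eta> j / t * (norm d)\<^sup>2
          - \<eta> j / t * (norm v)\<^sup>2 + \<eta> j * (\<alpha> + lg + norm l + norm m) * \<Delta> + ?K * (\<eta> j)\<^sup>2 * (norm d)\<^sup>2"
        using elim(1,2) by (intro merit_full_step_le step t(1) \<alpha>(1)) auto
      ultimately show "norm (h z) \<le> \<theta> / \<kappa> \<and>
        merit f g A h \<alpha> z \<le> merit f g A h \<alpha> x
          - \<sigma> / 2 * ((\<eta> j)\<^sup>2 * (norm d)\<^sup>2 + (\<tau> j)\<^sup>2 * norm (h ?y))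
          - \<eta> j / (2 * t) * (norm v)\<^sup>2 + \<eta> j * (\<alpha> + lg + norm l + norm m) * \<Delta>"
        using z unfolding distrib_left[of "\<sigma> / 2"] by simp
    qed
  qed
qed

end

section \<open>Convergence of the algorithm: finite backtracking, summation, limit\<close>

theorem theorem6:
  fixes f :: "real^'n \<Rightarrow> real" and g :: "real^'p \<Rightarrow> real"
    and A :: "real^'n \<Rightarrow> real^'p" and h :: "real^'n \<Rightarrow> real^'m"
    and M :: "(real^'n) set"
    and \<kappa> \<theta> C1 C2 Lh Lf LA lg lf lA :: real
    and \<gamma> \<alpha> tmin tmax \<Delta>max \<eta>max \<tau>max \<sigma> :: real
    and \<rho> t \<Delta> :: "nat \<Rightarrow> real"
    and x d :: "nat \<Rightarrow> real^'n" and v \<mu> :: "nat \<Rightarrow> real^'p" and lam :: "nat \<Rightarrow> real^'m"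
    and \<eta> \<tau> :: "nat \<Rightarrow> nat \<Rightarrow> real" and y xhat :: "nat \<Rightarrow> nat \<Rightarrow> real^'n"
    and accepted :: "nat \<Rightarrow> nat \<Rightarrow> bool" and J :: "nat \<Rightarrow> nat"
    and M1 M2 \<tau>hat :: real
  assumes \<comment> \<open>the problem\<close>
        M_compact: "compact M"
    and M_submanifold: "embedded_submanifold M"
    and f_C1: "\<forall>z. f differentiable (at z)" "continuous_on UNIV (gradient f)"
    and A_C1: "C1_map_on UNIV A"
    and g_closed: "closed (epigraph UNIV g)"
    and g_convex: "convex_on UNIV g"
  assumes \<comment> \<open>standing assumptions\<close>
        M_eq: "M = {z. h z = 0}"
    and kappa: "\<kappa> > 0" "\<forall>z. infdist z M \<le> \<kappa> * norm (h z)"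
    and h_diff: "\<forall>z. h differentiable (at z)"
    and h_lip: "Lh > 0" "\<forall>z w. spectral_norm (jac h z - jac h w) \<le> Lh * norm (z - w)"
    and h_eig: "\<theta> > 0" "0 < C1" "C1 \<le> C2"
      "\<forall>z\<in>tube M (2 * \<theta>). \<forall>e. is_eigenvalue (jac h z ** transpose (jac h z)) e \<longrightarrow>
          C1 \<le> e \<and> e \<le> C2"
    and f_lip: "Lf-lipschitz_on UNIV (gradient f)"
    and g_lip: "lg-lipschitz_on UNIV g"
    and A_lip: "\<forall>z w. spectral_norm (jac A z - jac A w) \<le> LA * norm (z - w)"
    and lf: "lf > 0" "\<forall>z\<in>tube M (2 * \<theta>). norm (gradient f z) \<le> lf"
    and lA: "lA > 0" "\<forall>z\<in>tube M (2 * \<theta>). spectral_norm (jac A z) \<le> lA"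
  assumes \<comment> \<open>inputs of the algorithm\<close>
        x0: "x 0 \<in> M"
    and gamma: "0 < \<gamma>" "\<gamma> < 1"
    and alpha_pos: "\<alpha> > 0"
    and t_bounds: "0 < tmin" "tmin \<le> tmax"
    and pos: "\<Delta>max > 0" "\<eta>max > 0" "\<tau>max > 0" "\<sigma> > 0"
    and rho: "\<forall>k. \<rho> k \<ge> 0" "summable \<rho>"
  assumes \<comment> \<open>outer iterations\<close>
        step1: "\<forall>k. tmin \<le> t k \<and> t k \<le> tmax" "\<forall>k. 0 \<le> \<Delta> k \<and> \<Delta> k \<le> \<Delta>max"
    and step2: "\<forall>k. norm (gradient (dual_objective f g A h (t k) (x k)) (lam k, \<mu> k)) \<le> \<Delta> k"
    and step3: "\<forall>k. d k = - t k *\<^sub>R dual_residual f A h (x k) (lam k) (\<mu> k)"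
      "\<forall>k. v k = prox (t k) g (A (x k) + t k *\<^sub>R \<mu> k) - A (x k)"
  assumes \<comment> \<open>inner loop: trial j of iteration k, first acceptance at j = J k\<close>
        step4: "\<forall>k. \<eta> k 0 = \<eta>max" "\<forall>k. \<tau> k 0 = \<tau>max"
    and backtrack: "\<forall>k j. \<eta> k (Suc j) = \<gamma> * \<eta> k j" "\<forall>k j. \<tau> k (Suc j) = \<gamma> / 2 * \<tau> k j"
    and step5_y: "\<forall>k j. y k j = x k + \<eta> k j *\<^sub>R d k"
    and step5_trial: "\<forall>k. \<forall>j\<le>J k. is_trial_point M h (\<theta> / \<kappa>) (\<tau> k j) (y k j) (xhat k j)"
    and accepted_iff: "\<forall>k j. accepted k j \<longleftrightarrow>
          norm (h (xhat k j)) \<le> \<theta> / \<kappa> \<and>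
          merit f g A h \<alpha> (xhat k j) \<le> merit f g A h \<alpha> (x k)
            - \<sigma> / 2 * ((\<eta> k j)\<^sup>2 * (norm (d k))\<^sup>2 + (\<tau> k j)\<^sup>2 * norm (h (y k j)))
            - \<eta> k j / (2 * t k) * (norm (v k))\<^sup>2
            + \<eta> k j * (\<alpha> + lg + norm (lam k) + norm (\<mu> k)) * \<Delta> k + \<rho> k"
    and rejected_before: "\<forall>k. \<forall>j<J k. \<not> accepted k j"
    and accept: "\<forall>k. accepted k (J k) \<and> x (Suc k) = xhat k (J k)"
  assumes \<comment> \<open>hypotheses on the parameters\<close>
        M1: "M1 = sqrt C2 * (lf + lg * lA)"
    and M2: "M2 = \<kappa> * (lf + lg * lA)"
    and tauhat: "\<tau>hat = min (2 * \<kappa> * C1 / (\<theta> * Lh * C2)) (1 / C2)"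
    and alpha: "\<alpha> > max (M1 / C1) (M2 + \<sigma> * \<tau>hat\<^sup>2 / 2)"
    and Delta_summable: "summable \<Delta>"
  shows "\<forall>xs. (\<exists>r. strict_mono r \<and> (x \<circ> r) \<longlonglongrightarrow> xs) \<longrightarrow> stationary_point f g A h xs"
proof -
  interpret composite_problem f g A h M \<kappa> \<theta> C1 C2 Lh Lf LA lg lf lA
  proof unfold_locales
    show "M \<noteq> {}" using x0 by blast
    show "A differentiable (at z)" for z using A_C1 by (simp add: C1_map_on_def)
  qed (use M_compact M_eq f_C1 g_convex kappa h_diff h_lip h_eig f_lip g_lip A_lip lf lA in blast)+

  have tmax: "0 < tmax" using t_bounds by simp
  have t_pos: "0 < t k" for k using t_bounds(1) step1(1) by (meson less_le_trans)
  have \<eta>_eq: "\<eta> k j = \<eta>max * \<gamma> ^ j" for k j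
    by (induction j) (use step4(1) backtrack(1) in auto)
  have \<tau>_eq: "\<tau> k j = \<tau>max * (\<gamma> / 2) ^ j" for k j
    by (induction j) (use step4(2) backtrack(2) in auto)
  have dual_step: "inexact_dual_step f g A h (t k) (\<Delta> k) (x k) (lam k) (\<mu> k) (d k) (v k)" for k
    using inexact_dual_step_if_gradient_small[OF g_convex g_lip t_pos] step2 step3 by blast
  have x_feas: "norm (h (x k)) \<le> \<theta> / \<kappa>" for k
  proof (cases k)
    case 0
    then show ?thesis using x0 M_eq h_eig(1) kappa(1) by simp
  next
    case (Suc i)
    then show ?thesis using accept accepted_iff by metis
  qed
  have x_dist: "infdist (x k) M \<le> \<theta>" for k
  proof -
    have "infdist (x k) M \<le> \<kappa> * norm (h (x k))" using kappa(2) by blast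
    also have "\<dots> \<le> \<theta>" using x_feas[of k] kappa(1) by (simp add: field_simps)
    finally show ?thesis .
  qed
  have x_tube: "x k \<in> tube M (2 * \<theta>)" for k
    using x_dist[of k] h_eig(1) by (simp add: tube_def)
  obtain B where B: "0 \<le> B" and bound: "\<forall>t \<Delta> x l m d v.
      inexact_dual_step f g A h t \<Delta> x l m d v \<longrightarrow> tmin \<le> t \<longrightarrow> t \<le> tmax \<longrightarrow> \<Delta> \<le> \<Delta>max \<longrightarrow>
      x \<in> tube M (2 * \<theta>) \<longrightarrow> norm d \<le> B \<and> norm v \<le> B \<and> norm l \<le> B \<and> norm m \<le> B"
    by (rule inexact_dual_step_bounded[OF t_bounds(1) less_imp_le[OF pos(1)], where tmax = tmax]) (rule that)
  have bounds: "norm (d k) \<le> B" "norm (v k) \<le> B" "norm (lam k) \<le> B" "norm (\<mu> k) \<le> B" for k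
    using bound[rule_format, OF dual_step, of k] step1 x_tube by simp_all

  have \<alpha>1: "sqrt C2 * (lf + lg * lA) < \<alpha> * C1"
    using alpha h_eig(2) unfolding M1 by (simp add: field_simps)
  have "0 \<le> \<sigma> * \<tau>hat\<^sup>2 / 2" using pos(4) by simp
  then have \<alpha>2: "\<kappa> * (lf + lg * lA) < \<alpha>"
    using alpha unfolding M2 by simp
  have lims: "filterlim (\<lambda>j. \<eta>max * \<gamma> ^ j) (at_right 0) sequentially"
    "filterlim (\<lambda>j. \<tau>max * (\<gamma> / 2) ^ j) (at_right 0) sequentially"
    using pos gamma by (auto intro!: filterlim_geometric_at_right_0)
  obtain N where N: "\<forall>x t \<Delta> l m d v z.
    infdist x M \<le> \<theta> \<longrightarrow> 0 < t \<longrightarrow> t \<le> tmax \<longrightarrow> norm d \<le> B \<longrightarrow>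
    inexact_dual_step f g A h t \<Delta> x l m d v \<longrightarrow>
    is_trial_point M h (\<theta> / \<kappa>) (\<tau>max * (\<gamma> / 2) ^ N) (x + (\<eta>max * \<gamma> ^ N) *\<^sub>R d) z \<longrightarrow>
    norm (h z) \<le> \<theta> / \<kappa> \<and>
    merit f g A h \<alpha> z \<le> merit f g A h \<alpha> x
      - \<sigma> / 2 * ((\<eta>max * \<gamma> ^ N)\<^sup>2 * (norm d)\<^sup>2
        + (\<tau>max * (\<gamma> / 2) ^ N)\<^sup>2 * norm (h (x + (\<eta>max * \<gamma> ^ N) *\<^sub>R d)))
      - (\<eta>max * \<gamma> ^ N) / (2 * t) * (norm v)\<^sup>2
      + (\<eta>max * \<gamma> ^ N) * (\<alpha> + lg + norm l + norm m) * \<Delta>"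
    using eventually_happens'[OF sequentially_bot
        eventually_trial_accepted[OF alpha_pos \<alpha>1 \<alpha>2 t_bounds(1) tmax B lims, of \<sigma>]]
    by (rule exE)
  \<comment> \<open>Were N < J k, trial N would have been computed and rejected, although it passes
    the test even before \<rho> k \<ge> 0 relaxes it.\<close>
  have J_le: "J k \<le> N" for k
  proof (rule ccontr)
    assume "\<not> J k \<le> N"
    then have N_less: "N < J k" by simp
    then have "is_trial_point M h (\<theta> / \<kappa>) (\<tau>max * (\<gamma> / 2) ^ N)
        (x k + (\<eta>max * \<gamma> ^ N) *\<^sub>R d k) (xhat k N)"
      using step5_trial step5_y by (metis \<eta>_eq \<tau>_eq less_imp_le)
    from N[rule_format, OF x_dist t_pos _ bounds(1) dual_step this] step1(1)
    have "norm (h (xhat k N)) \<le> \<theta> / \<kappa>" and "merit f g A h \<alpha> (xhat k N) \<le> merit f g A h \<alpha> (x k)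
        - \<sigma> / 2 * ((\<eta> k N)\<^sup>2 * (norm (d k))\<^sup>2 + (\<tau> k N)\<^sup>2 * norm (h (y k N)))
        - \<eta> k N / (2 * t k) * (norm (v k))\<^sup>2
        + \<eta> k N * (\<alpha> + lg + norm (lam k) + norm (\<mu> k)) * \<Delta> k"
      by (simp_all only: \<eta>_eq \<tau>_eq step5_y simp_thms)
    then have "accepted k N"
      unfolding accepted_iff[rule_format] using rho(1)[rule_format, of k] by (intro conjI; linarith)
    then show False using rejected_before N_less by blast
  qed

  define \<eta>N \<tau>N where "\<eta>N = \<eta>max * \<gamma> ^ N" and "\<tau>N = \<tau>max * (\<gamma> / 2) ^ N"
  have \<eta>N: "0 < \<eta>N" and \<tau>N: "0 < \<tau>N" using pos gamma by (simp_all add: \<eta>N_def \<tau>N_def)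
  have \<eta>_ge: "\<eta>N \<le> \<eta> k (J k)" and \<tau>_ge: "\<tau>N \<le> \<tau> k (J k)" for k
    unfolding \<eta>N_def \<tau>N_def \<eta>_eq \<tau>_eq using pos gamma J_le[of k]
    by (auto intro!: mult_left_mono power_decreasing)
  have \<eta>_le: "\<eta> k (J k) \<le> \<eta>max" for k
    unfolding \<eta>_eq using pos gamma by (simp add: mult_left_le power_le_one)
  define yJ where "yJ k = y k (J k)" for k
  \<comment> \<open>The guaranteed decrease with \<eta>, \<tau> and t at their worst values;
    \<open>e\<close> bounds the error terms from above in the same way.\<close>
  define a where "a k = \<sigma> / 2 * (\<eta>N\<^sup>2 * (norm (d k))\<^sup>2) + \<sigma> / 2 * (\<tau>N\<^sup>2 * norm (h (yJ k)))
    + \<eta>N / (2 * tmax) * (norm (v k))\<^sup>2" for k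
  define e where "e k = \<eta>max * (\<alpha> + lg + B + B) * \<Delta> k + \<rho> k" for k
  have a_parts: "\<sigma> / 2 * \<eta>N\<^sup>2 * norm (d k) ^ 2 \<le> a k" "\<sigma> / 2 * \<tau>N\<^sup>2 * norm (h (yJ k)) ^ 1 \<le> a k"
    "\<eta>N / (2 * tmax) * norm (v k) ^ 2 \<le> a k" "0 \<le> a k" for k
    using pos \<eta>N tmax unfolding a_def by simp_all
  have decrease: "merit f g A h \<alpha> (x (Suc k)) \<le> merit f g A h \<alpha> (x k) - a k + e k" for k
  proof -
    have "merit f g A h \<alpha> (x (Suc k)) \<le> merit f g A h \<alpha> (x k)
      - \<sigma> / 2 * ((\<eta> k (J k))\<^sup>2 * (norm (d k))\<^sup>2 + (\<tau> k (J k))\<^sup>2 * norm (h (yJ k)))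
      - \<eta> k (J k) / (2 * t k) * (norm (v k))\<^sup>2
      + \<eta> k (J k) * (\<alpha> + lg + norm (lam k) + norm (\<mu> k)) * \<Delta> k + \<rho> k"
      using accept accepted_iff unfolding yJ_def by metis
    moreover have "\<sigma> / 2 * (\<eta>N\<^sup>2 * (norm (d k))\<^sup>2) + \<sigma> / 2 * (\<tau>N\<^sup>2 * norm (h (yJ k)))
        \<le> \<sigma> / 2 * ((\<eta> k (J k))\<^sup>2 * (norm (d k))\<^sup>2 + (\<tau> k (J k))\<^sup>2 * norm (h (yJ k)))"
      unfolding distrib_left[symmetric] using pos(4) \<eta>N \<tau>N \<eta>_ge[of k] \<tau>_ge[of k]
      by (intro mult_left_mono add_mono mult_right_mono power_mono) auto
    moreover have "\<eta>N / (2 * tmax) * (norm (v k))\<^sup>2 \<le> \<eta> k (J k) / (2 * t k) * (norm (v k))\<^sup>2"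
      using \<eta>N \<eta>_ge[of k] t_pos[of k] step1(1)[rule_format, of k]
      by (intro mult_right_mono frac_le) auto
    moreover have "\<eta> k (J k) * (\<alpha> + lg + norm (lam k) + norm (\<mu> k)) * \<Delta> k
        \<le> \<eta>max * (\<alpha> + lg + B + B) * \<Delta> k"
      using \<eta>_le[of k] bounds[of k] step1(2)[rule_format, of k] pos(2) alpha_pos lg_nonneg
      by (intro mult_right_mono mult_mono) auto
    ultimately show ?thesis unfolding a_def e_def by linarith
  qed
  have e_nonneg: "0 \<le> e k" for k
    unfolding e_def using pos(2) alpha_pos lg_nonneg B step1(2) rho(1) by simp
  have e_summable: "summable e"
    unfolding e_def using Delta_summable rho(2) by (intro summable_add summable_mult)
  obtain c where c: "\<And>z. z \<in> tube M (2 * \<theta>) \<Longrightarrow> c \<le> merit f g A h \<alpha> z"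
    using merit_bounded_below_on_tube by blast
  have "summable a"
    by (rule summable_decrease[where \<Phi> = "\<lambda>k. merit f g A h \<alpha> (x k)",
          OF decrease a_parts(4) e_nonneg e_summable c[OF x_tube]])
  then have a_lim: "a \<longlonglongrightarrow> 0" by (rule summable_LIMSEQ_zero)
  have d_lim: "d \<longlonglongrightarrow> 0"
    by (rule tendsto_zero_if_scaled_norm_power_le[OF a_lim _ a_parts(1)]) (use pos(4) \<eta>N in simp_all)
  have h_lim: "(\<lambda>k. h (yJ k)) \<longlonglongrightarrow> 0"
    by (rule tendsto_zero_if_scaled_norm_power_le[OF a_lim _ a_parts(2)]) (use pos(4) \<tau>N in simp_all)
  have v_lim: "v \<longlonglongrightarrow> 0"
    by (rule tendsto_zero_if_scaled_norm_power_le[OF a_lim _ a_parts(3)]) (use tmax \<eta>N in simp_all)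
  \<comment> \<open>The summation gives h(y_k) -> 0 at the shifted points; this limit carries
    feasibility over to cluster points of x.\<close>
  have shift: "(\<lambda>k. \<eta> k (J k) *\<^sub>R d k) \<longlonglongrightarrow> 0"
  proof (rule Lim_null_comparison)
    show "\<forall>\<^sub>F k in sequentially. norm (\<eta> k (J k) *\<^sub>R d k) \<le> \<eta>max * norm (d k)"
    proof (rule always_eventually, rule allI)
      fix k
      have "0 \<le> \<eta> k (J k)" using \<eta>N \<eta>_ge[of k] by linarith
      then show "norm (\<eta> k (J k) *\<^sub>R d k) \<le> \<eta>max * norm (d k)"
        using \<eta>_le[of k] by (simp add: mult_right_mono)
    qed
    show "(\<lambda>k. \<eta>max * norm (d k)) \<longlonglongrightarrow> 0"
      using tendsto_mult[OF tendsto_const tendsto_norm[OF d_lim], of \<eta>max] by simp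
  qed

  show ?thesis
  proof (intro allI impI, elim exE conjE)
    fix xs r assume r: "strict_mono r" and x_lim: "(x \<circ> r) \<longlonglongrightarrow> xs"
    note sub = LIMSEQ_subseq_LIMSEQ[OF _ r]
    have "(yJ \<circ> r) \<longlonglongrightarrow> xs + 0"
      using tendsto_add[OF x_lim sub[OF shift]] by (simp add: yJ_def step5_y o_def)
    then have "(\<lambda>k. h ((yJ \<circ> r) k)) \<longlonglongrightarrow> h (xs + 0)"
      by (rule isCont_tendsto_compose[OF isCont_data(3)])
    then have "h xs = 0"
      using sub[OF h_lim] LIMSEQ_unique by (fastforce simp: o_def)
    then show "stationary_point f g A h xs"
      using stationary_point_if_steps_vanish[of "t \<circ> r" "\<Delta> \<circ> r" "x \<circ> r" "lam \<circ> r" "\<mu> \<circ> r" "d \<circ> r" "v \<circ> r"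
          tmin B xs] dual_step t_bounds(1) step1(1) bounds x_lim sub[OF d_lim] sub[OF v_lim]
      by simp
  qed
qed

end
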